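(* Let $0<T<1$ and $s>1$. For every $\varphi\in\mathcal{S}(\mathbb{R}^3)$, $$\|U(t)\varphi\|_{L^2_xL^\infty_{yzT}}\le C\|\varphi\|_{H^s(\mathbb{R}^3)},$$ where $C>0$ is a constant independent of $\varphi$ and $T$.
   Context: Write $\bar{x}=(x,y,z)\in\mathbb{R}^3$ with dual Fourier variable $\bar{\xi}=(\xi,\eta,\mu)$, and let $\mathcal{F}$ be the Fourier transform in space. Let $\omega(\bar{\xi})=\xi(\xi^2+\eta^2+\mu^2)$ and $U(t)=\mathcal{F}^{-1}e^{it\omega(\bar{\xi})}\mathcal{F}$, the group of the linear equation $u_t+\Delta u_x=0$. Mixed norms: $\|u\|_{L^p_xL^q_{yzT}}=\big\|\,\|u(\cdot,x,\cdot,\cdot)\|_{L^q_{t,y,z}([0,T]\times\mathbb{R}^2)}\big\|_{L^p_x(\mathbb{R})}$. *)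

theory Defs
  imports "HOL-Probability.Essential_Supremum"
begin

definition epowr :: "ennreal \<Rightarrow> real \<Rightarrow> ennreal" where
  "epowr a r = (if a = \<infinity> then \<infinity> else ennreal (enn2real a powr r))"

text \<open>
  \<open>Lp_norm p M f\<close> is the \<open>L\<^sup>p(M)\<close> norm of a nonnegative function, for \<open>0 < p \<le> \<infinity>\<close>.  It takes values
  in \<^typ>\<open>ennreal\<close> so that it can be iterated and so that bounding it includes its finiteness.
\<close>

definition Lp_norm :: "ennreal \<Rightarrow> 'a measure \<Rightarrow> ('a \<Rightarrow> ennreal) \<Rightarrow> ennreal" where
  "Lp_norm p M f =
     (if p = \<infinity> then esssup M f
      else epowr (\<integral>\<^sup>+ x. epowr (f x) (enn2real p) \<partial>M) (1 / enn2real p))"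

text \<open>
  \<open>iter_deriv [b\<^sub>1, \<dots>, b\<^sub>m] f = \<partial>\<^bsub>b\<^sub>1\<^esub> \<dots> \<partial>\<^bsub>b\<^sub>m\<^esub> f\<close>.  Lists of basis vectors play the role of
  multi-indices.
\<close>

fun iter_deriv :: "'a::euclidean_space list \<Rightarrow> ('a \<Rightarrow> complex) \<Rightarrow> 'a \<Rightarrow> complex" where
  "iter_deriv [] f = f"
| "iter_deriv (b # bs) f = (\<lambda>x. frechet_derivative (iter_deriv bs f) (at x) b)"

text \<open>
  Requiring every iterated partial derivative to be differentiable at every point makes \<open>f\<close>
  of class \<open>C\<^sup>\<infinity>\<close>.
\<close>

definition schwartz :: "('a::euclidean_space \<Rightarrow> complex) \<Rightarrow> bool" where
  "schwartz f \<longleftrightarrow>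
     (\<forall>bs. set bs \<subseteq> Basis \<longrightarrow>
        (\<forall>x. iter_deriv bs f differentiable (at x)) \<and>
        (\<forall>k. \<exists>B. \<forall>x. norm x ^ k * norm (iter_deriv bs f x) \<le> B))"

text \<open>
  The kernel is \<open>exp (- i x \<cdot> \<xi>)\<close>, without \<open>2\<pi>\<close> in the exponent: this is the convention for which
  the symbol \<open>\<omega>(\<xi>, \<eta>, \<mu>) = \<xi> (\<xi>\<^sup>2 + \<eta>\<^sup>2 + \<mu>\<^sup>2)\<close> generates the solutions of \<open>u\<^sub>t + \<Delta> u\<^sub>x = 0\<close>.  The
  normalisation makes the transform unitary on \<open>L\<^sup>2\<close>.
\<close>

definition fourier :: "('a::euclidean_space \<Rightarrow> complex) \<Rightarrow> 'a \<Rightarrow> complex" where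
  "fourier f \<xi> =
     complex_of_real ((2 * pi) powr (- real DIM('a) / 2)) * (\<integral>x. cis (- (x \<bullet> \<xi>)) * f x \<partial>lborel)"

definition inv_fourier :: "('a::euclidean_space \<Rightarrow> complex) \<Rightarrow> 'a \<Rightarrow> complex" where
  "inv_fourier g x =
     complex_of_real ((2 * pi) powr (- real DIM('a) / 2)) * (\<integral>\<xi>. cis (x \<bullet> \<xi>) * g \<xi> \<partial>lborel)"

definition sobolev_norm :: "real \<Rightarrow> ('a::euclidean_space \<Rightarrow> complex) \<Rightarrow> ennreal" where
  "sobolev_norm s f =
     Lp_norm 2 lborel (\<lambda>\<xi>. ennreal ((1 + (norm \<xi>)\<^sup>2) powr (s / 2) * norm (fourier f \<xi>)))"

text \<open>
  Three-dimensional space is \<open>\<real> \<times> \<real> \<times> \<real>\<close>, whose library norm, inner product and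
  measure \<^const>\<open>lborel\<close> are the Euclidean ones.
\<close>

type_synonym R3 = "real \<times> real \<times> real"

definition \<omega> :: "R3 \<Rightarrow> real" where
  "\<omega> = (\<lambda>(\<xi>, \<eta>, \<mu>). \<xi> * (\<xi>\<^sup>2 + \<eta>\<^sup>2 + \<mu>\<^sup>2))"

definition U :: "real \<Rightarrow> (R3 \<Rightarrow> complex) \<Rightarrow> R3 \<Rightarrow> complex" where
  "U t \<phi> = inv_fourier (\<lambda>\<xi>. cis (t * \<omega> \<xi>) * fourier \<phi> \<xi>)"

definition mixed_norm ::
  "ennreal \<Rightarrow> ennreal \<Rightarrow> real \<Rightarrow> (real \<Rightarrow> R3 \<Rightarrow> complex) \<Rightarrow> ennreal" where
  "mixed_norm p q T u =
     Lp_norm p lborel (\<lambda>x.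
       Lp_norm q (restrict_space lborel ({0..T} \<times> UNIV))
         (\<lambda>(t, y, z). ennreal (norm (u t (x, y, z)))))"

end

theory Submission
  imports Defs "HOL-Complex_Analysis.Cauchy_Integral_Theorem"
    "HOL-Probability.Characteristic_Functions" "HOL-Real_Asymp.Real_Asymp"
begin

text \<open>
  The estimate is proved by the \<open>TT\<^sup>*\<close> method.  Choosing for every \<open>x\<close> a point \<open>p x = (t, y, z)\<close> where the
  supremum is almost attained, one has to bound the linear map \<open>f \<mapsto> (\<lambda>x. evolution f (p x) x)\<close>, where
  \<open>f\<close> is the Fourier transform of the datum, from the weighted space of \<open>f\<close> to \<open>L\<^sup>2\<close>, uniformly in \<open>p\<close>.  By
  duality (\<open>linearised_maximal_bound\<close>) this is an estimate for the adjoint in \<open>L\<^sup>2\<close> with the weight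
  \<open>(1 + (norm \<xi>)\<^sup>2) powr (- s)\<close>.  That weight is at most a sum over \<open>k\<close> of Gaussians of width \<open>2 ^ k\<close> with
  coefficients proportional to \<open>4 powr (- s * k)\<close> (\<open>powr_weight_le_suminf\<close>).  For one Gaussian, the square of the adjoint
  is a quadratic form whose kernel is the space-time kernel of the propagator with that Gaussian as
  frequency cut-off, evaluated at \<open>p x - p x'\<close> and \<open>x - x'\<close>.  It therefore suffices to know the integral
  in \<open>x\<close> of the supremum of this kernel over times up to \<open>1\<close> and all \<open>y\<close> and \<open>z\<close>
  (\<open>evolution_adjoint_gaussian_bound\<close>).
  
  By scaling, the kernel at width \<open>2 ^ k\<close> reduces to the one at width \<open>1\<close> with times \<open>\<tau>\<close> up to \<open>8 ^ k\<close>.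
  There two effects cooperate (\<open>norm_kernel_le_integral\<close>).  For fixed first frequency \<open>\<xi>\<close> the
  transverse frequencies carry a complex Gaussian, whose integral is at most
  \<open>pi / norm (1 - \<i> * \<tau> * \<xi>)\<close>; integrating this in \<open>\<xi>\<close> yields the dispersive decay
  \<open>(1 + \<bar>\<tau>\<bar>) powr (\<epsilon> - 1)\<close>.  Moving the \<open>\<xi>\<close>-contour into the complex plane by a multiple of
  \<open>1 / (1 + \<bar>\<tau>\<bar>)\<close> yields, in addition, the factor \<open>exp (- \<bar>x\<bar> / (6 * (1 + \<bar>\<tau>\<bar>)))\<close>.  The product is at most
  \<open>(1 + \<bar>\<tau>\<bar>) powr (2 * \<epsilon>) * (1 + \<bar>x\<bar>) powr (- 1 - \<epsilon>)\<close> up to a constant (\<open>kernel_bound\<close>), which is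
  integrable in \<open>x\<close> at the price of a small power of \<open>\<tau>\<close>.  Undoing the scaling, the integral at width
  \<open>2 ^ k\<close> is at most a constant times \<open>2 powr (k * (2 + 6 * \<epsilon>))\<close>, and the sum over \<open>k\<close> converges for small
  \<open>\<epsilon>\<close> because \<open>s > 1\<close> (\<open>evolution_adjoint_sobolev_bound\<close>).
\<close>

section \<open>Gaussian integrals\<close>

lemma gaussian_fourier:
  fixes \<alpha> c :: real
  assumes "\<alpha> > 0"
  shows integrable_gaussian: "integrable lborel (\<lambda>x::real. exp (- \<alpha> * x\<^sup>2))"
    and integral_cis_gaussian:
      "(\<integral>x. cis (c * x) * complex_of_real (exp (- \<alpha> * x\<^sup>2)) \<partial>lborel)
        = complex_of_real (sqrt (pi / \<alpha>) * exp (- c\<^sup>2 / (4 * \<alpha>)))"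
    and integral_gaussian: "(\<integral>x. exp (- \<alpha> * x\<^sup>2) \<partial>lborel) = sqrt (pi / \<alpha>)"
proof -
  define s where "s = sqrt (2 * \<alpha>)"
  have s: "s > 0" "s\<^sup>2 = 2 * \<alpha>" using assms by (auto simp: s_def)
  have dens: "std_normal_density (s * x) = exp (- \<alpha> * x\<^sup>2) / sqrt (2 * pi)" for x
    by (simp add: std_normal_density_def power_mult_distrib s)
  have "integrable lborel (\<lambda>x. std_normal_density (0 + s * x))"
    using s by (intro lborel_integrable_real_affine integrable_normal_density) auto
  from integrable_mult_right[OF this, of "sqrt (2 * pi)"]
  show "integrable lborel (\<lambda>x::real. exp (- \<alpha> * x\<^sup>2))"
    by (simp add: dens)
  have main: "(\<integral>x. cis (c * x) * complex_of_real (exp (- \<alpha> * x\<^sup>2)) \<partial>lborel)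
        = complex_of_real (sqrt (pi / \<alpha>) * exp (- c\<^sup>2 / (4 * \<alpha>)))" for c
  proof -
    have "complex_of_real (exp (- (c / s)\<^sup>2 / 2)) = char std_normal_distribution (c / s)"
      by (simp add: char_std_normal_distribution)
    also have "\<dots> = (\<integral>x. std_normal_density x *\<^sub>R iexp (c / s * x) \<partial>lborel)"
      unfolding char_def by (subst integral_density) auto
    also have "\<dots> = \<bar>s\<bar> *\<^sub>R (\<integral>x. std_normal_density (0 + s * x) *\<^sub>R iexp (c / s * (0 + s * x)) \<partial>lborel)"
      using s by (intro lborel_integral_real_affine) auto
    also have "(\<lambda>x. std_normal_density (0 + s * x) *\<^sub>R iexp (c / s * (0 + s * x)))
       = (\<lambda>x. complex_of_real (1 / sqrt (2 * pi)) * (cis (c * x) * complex_of_real (exp (- \<alpha> * x\<^sup>2))))"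
    proof
      fix x
      have "c / s * (0 + s * x) = c * x" using s by simp
      then show "std_normal_density (0 + s * x) *\<^sub>R iexp (c / s * (0 + s * x))
         = complex_of_real (1 / sqrt (2 * pi)) * (cis (c * x) * complex_of_real (exp (- \<alpha> * x\<^sup>2)))"
        unfolding add_0 dens by (simp add: cis_conv_exp scaleR_conv_of_real)
    qed
    also have "\<bar>s\<bar> *\<^sub>R (\<integral>x. complex_of_real (1 / sqrt (2 * pi)) * (cis (c * x) * complex_of_real (exp (- \<alpha> * x\<^sup>2))) \<partial>lborel)
       = complex_of_real (s / sqrt (2 * pi)) * (\<integral>x. cis (c * x) * complex_of_real (exp (- \<alpha> * x\<^sup>2)) \<partial>lborel)"
      using s by (subst integral_mult_right_zero) (simp add: scaleR_conv_of_real)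
    finally have eq: "complex_of_real (exp (- (c / s)\<^sup>2 / 2)) = complex_of_real (s / sqrt (2 * pi)) * (\<integral>x. cis (c * x) * complex_of_real (exp (- \<alpha> * x\<^sup>2)) \<partial>lborel)" .
    have "(\<integral>x. cis (c * x) * complex_of_real (exp (- \<alpha> * x\<^sup>2)) \<partial>lborel)
       = complex_of_real (sqrt (2 * pi) / s) * complex_of_real (exp (- (c / s)\<^sup>2 / 2))"
      unfolding eq using s by (simp add: field_simps)
    also have "sqrt (2 * pi) / s = sqrt (pi / \<alpha>)"
      using assms by (simp add: s_def real_sqrt_mult real_sqrt_divide)
    also have "- (c / s)\<^sup>2 / 2 = - c\<^sup>2 / (4 * \<alpha>)" by (simp add: power_divide s)
    finally show ?thesis by simp
  qed
  from main show "(\<integral>x. cis (c * x) * complex_of_real (exp (- \<alpha> * x\<^sup>2)) \<partial>lborel)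
        = complex_of_real (sqrt (pi / \<alpha>) * exp (- c\<^sup>2 / (4 * \<alpha>)))" .
  have "complex_of_real (\<integral>x. exp (- \<alpha> * x\<^sup>2) \<partial>lborel) = complex_of_real (sqrt (pi / \<alpha>))"
    using main[of 0] by (simp flip: integral_complex_of_real)
  then show "(\<integral>x. exp (- \<alpha> * x\<^sup>2) \<partial>lborel) = sqrt (pi / \<alpha>)"
    by (simp only: of_real_eq_iff)
qed

lemma (in pair_sigma_finite) integrable_times:
  fixes f :: "'a \<Rightarrow> 'c::{banach, second_countable_topology, real_normed_div_algebra}"
  assumes [measurable]: "integrable M1 f" "integrable M2 g"
  shows "integrable (M1 \<Otimes>\<^sub>M M2) (\<lambda>(x, y). f x * g y)"
proof (rule Fubini_integrable)
  show "(\<lambda>(x, y). f x * g y) \<in> borel_measurable (M1 \<Otimes>\<^sub>M M2)" by measurable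
  show "integrable M1 (\<lambda>x. \<integral>y. norm (case (x, y) of (x, y) \<Rightarrow> f x * g y) \<partial>M2)"
    using assms by (simp add: norm_mult)
  show "AE x in M1. integrable M2 (\<lambda>y. case (x, y) of (x, y) \<Rightarrow> f x * g y)"
    using assms by simp
qed

lemma integrable_gaussian_Pair:
  assumes "integrable lborel (\<lambda>x::'a::euclidean_space. exp (- \<alpha> * (norm x)\<^sup>2))"
    and "integrable lborel (\<lambda>y::'b::euclidean_space. exp (- \<alpha> * (norm y)\<^sup>2))"
  shows "integrable lborel (\<lambda>p::'a \<times> 'b. exp (- \<alpha> * (norm p)\<^sup>2))"
proof -
  have "integrable (lborel \<Otimes>\<^sub>M lborel) (\<lambda>(x::'a, y::'b). exp (- \<alpha> * (norm x)\<^sup>2) * exp (- \<alpha> * (norm y)\<^sup>2))"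
    by (rule lborel_pair.integrable_times[OF assms])
  also have "(\<lambda>(x::'a, y::'b). exp (- \<alpha> * (norm x)\<^sup>2) * exp (- \<alpha> * (norm y)\<^sup>2))
      = (\<lambda>p. exp (- \<alpha> * (norm p)\<^sup>2))"
    by (auto simp: norm_Pair algebra_simps simp flip: exp_add)
  finally show ?thesis by (simp only: lborel_prod)
qed

lemma integrable_gaussian_R2:
  "\<alpha> > 0 \<Longrightarrow> integrable lborel (\<lambda>q::real \<times> real. exp (- \<alpha> * (norm q)\<^sup>2))"
  by (intro integrable_gaussian_Pair) (simp_all only: real_norm_def power2_abs integrable_gaussian)

lemma integrable_gaussian_R3:
  "\<alpha> > 0 \<Longrightarrow> integrable lborel (\<lambda>\<xi>::R3. exp (- \<alpha> * (norm \<xi>)\<^sup>2))"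
  by (intro integrable_gaussian_Pair[of \<alpha>] integrable_gaussian_R2)
     (simp_all only: real_norm_def power2_abs integrable_gaussian)

lemma integrable_chirp:
  assumes "Re b > 0"
  shows "integrable lborel (\<lambda>x::real. exp (- b * of_real (x\<^sup>2) + \<i> * of_real (y * x)))"
proof (rule Bochner_Integration.integrable_bound[OF integrable_gaussian[OF assms]])
  show "AE x in lborel. norm (exp (- b * of_real (x\<^sup>2) + \<i> * of_real (y * x))) \<le> norm (exp (- Re b * x\<^sup>2))"
    by (simp del: of_real_power of_real_mult)
qed measurable

lemma borel_measurable_cnj [measurable (raw)]:
  "f \<in> borel_measurable M \<Longrightarrow> (\<lambda>x. cnj (f x)) \<in> borel_measurable M"
  by (erule measurable_compose) (intro borel_measurable_continuous_onI continuous_intros)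

text \<open>
  This is the dispersive estimate in one transverse variable.  The complex Gaussian integral is avoided by expanding
  \<open>\<bar>J\<bar>\<^sup>2\<close> as a double integral: in the difference \<open>u\<close> and the midpoint \<open>v\<close> of the two
  variables the quadratic part of the phase becomes bilinear, so that the \<open>v\<close>-integral is the
  Fourier transform of a real Gaussian.  It produces the additional decay \<open>exp (- (Im b)\<^sup>2 u\<^sup>2 / (2 Re b))\<close>
  in \<open>u\<close>, which is what turns \<open>Re b\<close> into \<open>norm b\<close>.
\<close>

lemma norm_integral_chirp_le:
  assumes "Re b > 0"
  shows "(norm (\<integral>x. exp (- b * of_real (x\<^sup>2) + \<i> * of_real (y * x)) \<partial>lborel))\<^sup>2 \<le> pi / norm b"
proof -
  define \<beta> \<gamma> where "\<beta> = Re b" and "\<gamma> = Im b"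
  have \<beta>: "\<beta> > 0" using assms by (simp add: \<beta>_def)
  define g where "g x = exp (- b * of_real (x\<^sup>2) + \<i> * of_real (y * x))" for x :: real
  define J where "J = (\<integral>x. g x \<partial>lborel)"
  have g_int: "integrable lborel g"
    unfolding g_def using assms by (rule integrable_chirp)
  have [measurable]: "g \<in> borel_measurable borel" unfolding g_def by measurable
  have norm_g: "norm (g x) = exp (- \<beta> * x\<^sup>2)" for x
    by (simp add: g_def \<beta>_def del: of_real_power of_real_mult)
  define K where "K u x = g (u + x) * cnj (g x)" for u x
  have K_int: "integrable (lborel \<Otimes>\<^sub>M lborel) (\<lambda>(u, x). K u x)"
  proof (rule Bochner_Integration.integrable_bound)
    show "integrable (lborel \<Otimes>\<^sub>M lborel) (\<lambda>(u::real, x::real). exp (- (\<beta>/3) * u\<^sup>2) * exp (- (\<beta>/3) * x\<^sup>2))"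
      using \<beta> by (intro lborel_pair.integrable_times integrable_gaussian) auto
    show "(\<lambda>(u, x). K u x) \<in> borel_measurable (lborel \<Otimes>\<^sub>M lborel)"
      unfolding K_def by measurable
    have "norm (K u x) \<le> exp (- (\<beta>/3) * u\<^sup>2) * exp (- (\<beta>/3) * x\<^sup>2)" for u x
    proof -
      \<comment> \<open>Comparing \<open>(u + x)\<^sup>2 + x\<^sup>2\<close> with a third of \<open>u\<^sup>2 + x\<^sup>2\<close> by completing the square.\<close>
      have "0 \<le> (5 * x + 3 * u)\<^sup>2 / 15 + u\<^sup>2 / 15" by simp
      also have "\<dots> = (u + x)\<^sup>2 + x\<^sup>2 - (u\<^sup>2 / 3 + x\<^sup>2 / 3)" by (simp add: field_simps power2_eq_square)
      finally have "\<beta> * (u\<^sup>2 / 3 + x\<^sup>2 / 3) \<le> \<beta> * ((u + x)\<^sup>2 + x\<^sup>2)"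
        using \<beta> by (intro mult_left_mono) auto
      then show ?thesis
        unfolding K_def norm_mult complex_mod_cnj norm_g by (simp add: algebra_simps flip: exp_add)
    qed
    then show "AE p in lborel \<Otimes>\<^sub>M lborel. norm (case p of (u, x) \<Rightarrow> K u x)
        \<le> norm (case p of (u, x) \<Rightarrow> exp (- (\<beta>/3) * u\<^sup>2) * exp (- (\<beta>/3) * x\<^sup>2))"
      by auto
  qed
  have "J * cnj J = (\<integral>x. J * cnj (g x) \<partial>lborel)"
    by (simp add: J_def)
  also have "\<dots> = (\<integral>x. (\<integral>u. K u x \<partial>lborel) \<partial>lborel)"
  proof (rule Bochner_Integration.integral_cong[OF refl])
    fix x
    have "J = (\<integral>u. g (x + 1 * u) \<partial>lborel)"
      unfolding J_def by (subst lborel_integral_real_affine[of 1 _ x]) simp_all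
    then show "J * cnj (g x) = (\<integral>u. K u x \<partial>lborel)"
      unfolding K_def by (simp add: add.commute)
  qed
  also have "\<dots> = (\<integral>u. (\<integral>x. K u x \<partial>lborel) \<partial>lborel)"
    by (rule lborel_pair.Fubini_integral[OF K_int])
  also have "\<dots> = (\<integral>u. complex_of_real (exp (- \<beta> * u\<^sup>2 / 2)) * cis (y * u) *
      complex_of_real (sqrt (pi / (2 * \<beta>)) * exp (- (- 2 * \<gamma> * u)\<^sup>2 / (4 * (2 * \<beta>)))) \<partial>lborel)"
  proof (rule Bochner_Integration.integral_cong[OF refl])
    fix u
    \<comment> \<open>The midpoint of \<open>u + x\<close> and \<open>x\<close> becomes the new variable.\<close>
    have "(\<integral>x. K u x \<partial>lborel) = (\<integral>v. K u (- u / 2 + 1 * v) \<partial>lborel)"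
      by (subst lborel_integral_real_affine[of 1 _ "- u / 2"]) simp_all
    also have "\<dots> = (\<integral>v. (complex_of_real (exp (- \<beta> * u\<^sup>2 / 2)) * cis (y * u)) *
       (cis (- 2 * \<gamma> * u * v) * complex_of_real (exp (- (2 * \<beta>) * v\<^sup>2))) \<partial>lborel)"
    proof (rule Bochner_Integration.integral_cong[OF refl])
      fix v
      have b: "b = of_real \<beta> + \<i> * of_real \<gamma>" by (simp add: \<beta>_def \<gamma>_def complex_eq_iff)
      show "K u (- u / 2 + 1 * v) = (complex_of_real (exp (- \<beta> * u\<^sup>2 / 2)) * cis (y * u)) *
       (cis (- 2 * \<gamma> * u * v) * complex_of_real (exp (- (2 * \<beta>) * v\<^sup>2)))"
        unfolding K_def g_def b
        by (simp add: exp_cnj cis_conv_exp exp_of_real[symmetric] flip: exp_add)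
          (rule arg_cong[where f = exp], simp add: field_simps power2_eq_square)
    qed
    also have "\<dots> = complex_of_real (exp (- \<beta> * u\<^sup>2 / 2)) * cis (y * u) *
      complex_of_real (sqrt (pi / (2 * \<beta>)) * exp (- (- 2 * \<gamma> * u)\<^sup>2 / (4 * (2 * \<beta>))))"
      by (subst integral_mult_right_zero, subst integral_cis_gaussian) (use \<beta> in auto)
    finally show "(\<integral>x. K u x \<partial>lborel) = \<dots>" .
  qed
  finally have JJ: "J * cnj J = \<dots>" .
  define \<delta> where "\<delta> = \<beta> / 2 + \<gamma>\<^sup>2 / (2 * \<beta>)"
  have \<delta>: "\<delta> > 0" using \<beta> by (auto simp: \<delta>_def intro!: add_pos_nonneg)
  have nb: "(norm b)\<^sup>2 = \<beta>\<^sup>2 + \<gamma>\<^sup>2" by (simp add: cmod_power2 \<beta>_def \<gamma>_def)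
  have "(norm J)\<^sup>2 = norm (J * cnj J)" by (simp add: norm_mult power2_eq_square)
  also have "\<dots> \<le> (\<integral>u. norm (complex_of_real (exp (- \<beta> * u\<^sup>2 / 2)) * cis (y * u) *
      complex_of_real (sqrt (pi / (2 * \<beta>)) * exp (- (- 2 * \<gamma> * u)\<^sup>2 / (4 * (2 * \<beta>))))) \<partial>lborel)"
    unfolding JJ by (rule integral_norm_bound)
  also have "\<dots> = (\<integral>u. sqrt (pi / (2 * \<beta>)) * exp (- \<delta> * u\<^sup>2) \<partial>lborel)"
  proof (rule Bochner_Integration.integral_cong[OF refl])
    fix u
    have "- \<delta> * u\<^sup>2 = - \<beta> * u\<^sup>2 / 2 + - (- 2 * \<gamma> * u)\<^sup>2 / (4 * (2 * \<beta>))"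
      using \<beta> by (simp add: \<delta>_def field_simps power2_eq_square)
    then show "norm (complex_of_real (exp (- \<beta> * u\<^sup>2 / 2)) * cis (y * u) *
      complex_of_real (sqrt (pi / (2 * \<beta>)) * exp (- (- 2 * \<gamma> * u)\<^sup>2 / (4 * (2 * \<beta>)))))
      = sqrt (pi / (2 * \<beta>)) * exp (- \<delta> * u\<^sup>2)"
      using \<beta> by (simp only: exp_add) (simp add: norm_mult)
  qed
  also have "\<dots> = sqrt (pi / (2 * \<beta>)) * sqrt (pi / \<delta>)"
    using integral_gaussian[OF \<delta>] by simp
  also have "\<dots> = sqrt (pi\<^sup>2 / (norm b)\<^sup>2)"
    unfolding nb using \<beta> by (simp add: \<delta>_def field_simps power2_eq_square flip: real_sqrt_mult)
  also have "\<dots> = pi / norm b" by (simp add: real_sqrt_divide)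
  finally show ?thesis unfolding J_def g_def .
qed

section \<open>Contour shift and decay of the dispersive factor\<close>

text \<open>
  Cauchy's theorem for a long thin rectangle: \<open>F\<close> has a primitive \<open>P\<close>, so the integral over a
  horizontal segment is a difference of values of \<open>P\<close>, and passing from one line to the other
  changes these values by at most the Gaussian size of \<open>F\<close> at the two ends.
\<close>

lemma integral_shift_line:
  fixes F :: "complex \<Rightarrow> complex"
  assumes hol: "F holomorphic_on UNIV" and "\<alpha> > 0"
    and bound: "\<And>\<xi> r. \<bar>r\<bar> \<le> \<bar>\<sigma>\<bar> \<Longrightarrow> norm (F (of_real \<xi> + \<i> * of_real r)) \<le> B * exp (- \<alpha> * \<xi>\<^sup>2)"
  shows "(\<integral>\<xi>. F (of_real \<xi> + \<i> * of_real \<sigma>) \<partial>lborel) = (\<integral>\<xi>. F (of_real \<xi>) \<partial>lborel)"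
proof -
  obtain P where P: "\<And>z. (P has_field_derivative F z) (at z)"
    using holomorphic_convex_primitive'[OF convex_UNIV open_UNIV hol] by auto
  define z where "z \<xi> r = complex_of_real \<xi> + \<i> * of_real r" for \<xi> r :: real
  have contF: "continuous_on UNIV (\<lambda>\<xi>. F (z \<xi> r))" for r
    unfolding z_def
    by (rule continuous_on_compose2[OF holomorphic_on_imp_continuous_on[OF hol]])
       (auto intro!: continuous_intros)
  have [measurable]: "(\<lambda>\<xi>. F (z \<xi> r)) \<in> borel_measurable borel" for r
    by (rule borel_measurable_continuous_onI[OF contF])
  have line: "(\<integral>\<xi>. indicator {- real n..real n} \<xi> *\<^sub>R F (z \<xi> r) \<partial>lborel) = P (z n r) - P (z (- n) r)" for n r
  proof (rule integral_FTC_Icc)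
    fix x
    have "((\<lambda>\<xi>. z \<xi> r) has_vector_derivative 1) (at x within {- real n..real n})"
      unfolding z_def by (auto intro!: derivative_eq_intros)
    from field_vector_diff_chain_within[OF this has_field_derivative_at_within[OF P]]
    show "((\<lambda>\<xi>. P (z \<xi> r)) has_vector_derivative F (z x r)) (at x within {- real n..real n})"
      by (simp add: o_def)
  qed (auto intro: continuous_on_subset[OF contF])
  have lim: "(\<lambda>n. P (z (real n) r) - P (z (- real n) r)) \<longlonglongrightarrow> (\<integral>\<xi>. F (z \<xi> r) \<partial>lborel)" if r: "\<bar>r\<bar> \<le> \<bar>\<sigma>\<bar>" for r
    unfolding line[symmetric]
  proof (rule integral_dominated_convergence)
    show "integrable lborel (\<lambda>\<xi>::real. B * exp (- \<alpha> * \<xi>\<^sup>2))"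
      using integrable_gaussian[OF \<open>\<alpha> > 0\<close>] by (intro integrable_mult_right)
    show "AE \<xi> in lborel. (\<lambda>n. indicator {- real n..real n} \<xi> *\<^sub>R F (z \<xi> r)) \<longlonglongrightarrow> F (z \<xi> r)"
    proof (rule AE_I2)
      fix \<xi> :: real
      have "\<forall>\<^sub>F n in sequentially. \<bar>\<xi>\<bar> \<le> real n"
        using eventually_ge_at_top[of "nat \<lceil>\<bar>\<xi>\<bar>\<rceil>"] by eventually_elim linarith
      then have "\<forall>\<^sub>F n in sequentially. indicator {- real n..real n} \<xi> *\<^sub>R F (z \<xi> r) = F (z \<xi> r)"
        by eventually_elim (auto simp: abs_le_iff)
      then show "(\<lambda>n. indicator {- real n..real n} \<xi> *\<^sub>R F (z \<xi> r)) \<longlonglongrightarrow> F (z \<xi> r)"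
        by (rule tendsto_eventually)
    qed
    show "AE \<xi> in lborel. norm (indicator {- real n..real n} \<xi> *\<^sub>R F (z \<xi> r)) \<le> B * exp (- \<alpha> * \<xi>\<^sup>2)" for n
    proof (rule AE_I2)
      fix \<xi> :: real
      have "norm (F (z \<xi> r)) \<le> B * exp (- \<alpha> * \<xi>\<^sup>2)" using bound[OF r] by (simp add: z_def)
      then show "norm (indicator {- real n..real n} \<xi> *\<^sub>R F (z \<xi> r)) \<le> B * exp (- \<alpha> * \<xi>\<^sup>2)"
        using norm_ge_zero[of "F (z \<xi> r)"] by (auto split: split_indicator simp del: norm_ge_zero)
    qed
  qed measurable
  have side: "norm (P (z \<xi> \<sigma>) - P (z \<xi> 0)) \<le> B * exp (- \<alpha> * \<xi>\<^sup>2) * \<bar>\<sigma>\<bar>" for \<xi>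
  proof -
    have "norm (P (z \<xi> \<sigma>) - P (z \<xi> 0)) \<le> B * exp (- \<alpha> * \<xi>\<^sup>2) * norm (z \<xi> \<sigma> - z \<xi> 0)"
    proof (rule field_differentiable_bound[where S = "closed_segment (z \<xi> 0) (z \<xi> \<sigma>)"])
      fix w assume "w \<in> closed_segment (z \<xi> 0) (z \<xi> \<sigma>)"
      then obtain u where u: "0 \<le> u" "u \<le> 1" "w = (1 - u) *\<^sub>R z \<xi> 0 + u *\<^sub>R z \<xi> \<sigma>"
        by (auto simp: in_segment)
      then have w: "w = z \<xi> (u * \<sigma>)"
        by (simp add: z_def scaleR_conv_of_real algebra_simps)
      have "\<bar>u * \<sigma>\<bar> \<le> \<bar>\<sigma>\<bar>" using u by (simp add: abs_mult mult_left_le_one_le)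
      then show "norm (F w) \<le> B * exp (- \<alpha> * \<xi>\<^sup>2)"
        unfolding w z_def by (rule bound)
    qed (auto intro: has_field_derivative_at_within[OF P])
    also have "norm (z \<xi> \<sigma> - z \<xi> 0) = \<bar>\<sigma>\<bar>" by (simp add: z_def norm_mult)
    finally show ?thesis .
  qed
  have "(\<lambda>n. B * exp (- \<alpha> * (real n)\<^sup>2) * \<bar>\<sigma>\<bar>) \<longlonglongrightarrow> B * 0 * \<bar>\<sigma>\<bar>"
    using \<open>\<alpha> > 0\<close> by (intro tendsto_intros) real_asymp
  then have g0: "(\<lambda>n. B * exp (- \<alpha> * (real n)\<^sup>2) * \<bar>\<sigma>\<bar>) \<longlonglongrightarrow> 0" by simp
  have "(\<lambda>n. P (z (real n) \<sigma>) - P (z (real n) 0)) \<longlonglongrightarrow> 0"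
    by (rule Lim_null_comparison[OF always_eventually g0]) (use side in auto)
  moreover have "(\<lambda>n. P (z (- real n) \<sigma>) - P (z (- real n) 0)) \<longlonglongrightarrow> 0"
    by (rule Lim_null_comparison[OF always_eventually g0]) (use side[of "- real _"] in auto)
  ultimately have "(\<lambda>n. (P (z (real n) \<sigma>) - P (z (real n) 0)) - (P (z (- real n) \<sigma>) - P (z (- real n) 0))) \<longlonglongrightarrow> 0 - 0"
    by (rule tendsto_diff)
  moreover have "(\<lambda>n. (P (z (real n) \<sigma>) - P (z (- real n) \<sigma>)) - (P (z (real n) 0) - P (z (- real n) 0)))
      \<longlonglongrightarrow> (\<integral>\<xi>. F (z \<xi> \<sigma>) \<partial>lborel) - (\<integral>\<xi>. F (z \<xi> 0) \<partial>lborel)"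
    by (intro tendsto_diff lim) auto
  ultimately have "(\<integral>\<xi>. F (z \<xi> \<sigma>) \<partial>lborel) - (\<integral>\<xi>. F (z \<xi> 0) \<partial>lborel) = 0 - 0"
    by (intro LIMSEQ_unique) (auto simp: algebra_simps)
  then show ?thesis by (simp add: z_def)
qed

text \<open>
  After the transverse integrations the kernel at time \<open>\<tau>\<close> is bounded by this integral.  It behaves
  like \<open>ln \<bar>\<tau>\<bar> / \<bar>\<tau>\<bar>\<close> for large \<open>\<tau>\<close>; the logarithm is traded for a power \<open>\<epsilon>\<close> by the interpolation
  \<open>1 / m \<le> m powr (\<epsilon> - 1)\<close>, which leaves an integrable singularity at \<open>\<xi> = 0\<close>.
\<close>

lemma integral_inverse_max_gaussian_le:
  assumes "0 < \<epsilon>" "\<epsilon> < 1"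
  shows "\<exists>C>0. \<forall>\<tau>. integrable lborel (\<lambda>\<xi>::real. exp (- \<xi>\<^sup>2 / 2) / max 1 \<bar>\<tau> * \<xi>\<bar>) \<and>
     (\<integral>\<xi>. exp (- \<xi>\<^sup>2 / 2) / max 1 \<bar>\<tau> * \<xi>\<bar> \<partial>lborel) \<le> C * (1 + \<bar>\<tau>\<bar>) powr (\<epsilon> - 1)"
proof -
  define w where "w \<xi> = exp (- (1/2) * \<xi>\<^sup>2) + indicator {0<..1} \<xi> *\<^sub>R \<xi> powr (\<epsilon> - 1)
      + indicator {0<..1} (- \<xi>) *\<^sub>R (- \<xi>) powr (\<epsilon> - 1)" for \<xi> :: real
  have "set_integrable lebesgue {0<..1} (\<lambda>\<xi>::real. \<xi> powr (\<epsilon> - 1))"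
    using assms by (intro nonnegative_absolutely_integrable_1 integrable_on_powr_from_0') auto
  then have p: "integrable lborel (\<lambda>\<xi>::real. indicator {0<..1} \<xi> *\<^sub>R \<xi> powr (\<epsilon> - 1))"
    unfolding set_integrable_def by (subst (asm) integrable_completion) measurable
  have "integrable lborel (\<lambda>\<xi>::real. indicator {0<..1} (0 + (-1) * \<xi>) *\<^sub>R (0 + (-1) * \<xi>) powr (\<epsilon> - 1))"
    by (rule lborel_integrable_real_affine[OF p]) simp
  then have w_int: "integrable lborel w"
    unfolding w_def by (intro Bochner_Integration.integrable_add integrable_gaussian p) simp_all
  have w_nonneg: "0 \<le> w \<xi>" for \<xi> by (simp add: w_def)
  have main: "exp (- \<xi>\<^sup>2 / 2) / max 1 \<bar>\<tau> * \<xi>\<bar> \<le> 2 * (1 + \<bar>\<tau>\<bar>) powr (\<epsilon> - 1) * w \<xi>" if "\<xi> \<noteq> 0" for \<tau> \<xi> :: real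
  proof -
    define m where "m = max 1 \<bar>\<tau> * \<xi>\<bar>"
    have m: "m \<ge> 1" "m \<ge> \<bar>\<tau> * \<xi>\<bar>" by (auto simp: m_def)
    have "1 / m = m powr (- 1)" using m by (simp add: powr_minus_divide)
    also have "\<dots> \<le> m powr (\<epsilon> - 1)" using m assms by (intro powr_mono) auto
    finally have 1: "1 / m \<le> m powr (\<epsilon> - 1)" .
    have half: "(1/2) powr (\<epsilon> - 1) \<le> (2::real)"
      using powr_mono[of "1 - \<epsilon>" 1 2] assms by (simp add: powr_minus_divide powr_divide powr_diff)
    show ?thesis
    proof (cases "\<bar>\<xi>\<bar> \<le> 1")
      case True
      have "(1 + \<bar>\<tau>\<bar>) * \<bar>\<xi>\<bar> \<le> 2 * m"
        using True m by (simp add: abs_mult algebra_simps)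
      then have "m powr (\<epsilon> - 1) \<le> ((1/2) * ((1 + \<bar>\<tau>\<bar>) * \<bar>\<xi>\<bar>)) powr (\<epsilon> - 1)"
        using assms that by (intro powr_mono2') auto
      also have "\<dots> = (1/2) powr (\<epsilon> - 1) * ((1 + \<bar>\<tau>\<bar>) powr (\<epsilon> - 1) * \<bar>\<xi>\<bar> powr (\<epsilon> - 1))"
        by (simp only: powr_mult abs_ge_zero add_nonneg_nonneg zero_le_one mult_nonneg_nonneg)
      also have "\<dots> \<le> 2 * ((1 + \<bar>\<tau>\<bar>) powr (\<epsilon> - 1) * \<bar>\<xi>\<bar> powr (\<epsilon> - 1))"
        using half by (intro mult_right_mono) auto
      also have "\<dots> \<le> 2 * ((1 + \<bar>\<tau>\<bar>) powr (\<epsilon> - 1) * w \<xi>)"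
        using True that by (intro mult_left_mono) (auto simp: w_def split: split_indicator)
      finally have "1 / m \<le> 2 * (1 + \<bar>\<tau>\<bar>) powr (\<epsilon> - 1) * w \<xi>"
        using 1 by simp
      moreover have "exp (- \<xi>\<^sup>2 / 2) / m \<le> 1 / m" using m by (intro divide_right_mono) auto
      ultimately show ?thesis by (simp add: m_def)
    next
      case False
      have "\<bar>\<tau>\<bar> * 1 \<le> \<bar>\<tau>\<bar> * \<bar>\<xi>\<bar>" using False by (intro mult_left_mono) auto
      then have "(1 + \<bar>\<tau>\<bar>) \<le> 2 * m"
        using m by (simp add: abs_mult)
      then have "m powr (\<epsilon> - 1) \<le> ((1/2) * (1 + \<bar>\<tau>\<bar>)) powr (\<epsilon> - 1)"
        using assms by (intro powr_mono2') auto
      also have "\<dots> = (1/2) powr (\<epsilon> - 1) * (1 + \<bar>\<tau>\<bar>) powr (\<epsilon> - 1)"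
        by (simp only: powr_mult abs_ge_zero add_nonneg_nonneg zero_le_one)
      also have "\<dots> \<le> 2 * (1 + \<bar>\<tau>\<bar>) powr (\<epsilon> - 1)"
        using half by (intro mult_right_mono) auto
      finally have "1 / m \<le> 2 * (1 + \<bar>\<tau>\<bar>) powr (\<epsilon> - 1)"
        using 1 by simp
      then have "1 / m * exp (- \<xi>\<^sup>2 / 2) \<le> 2 * (1 + \<bar>\<tau>\<bar>) powr (\<epsilon> - 1) * w \<xi>"
        using m by (intro mult_mono) (auto simp: w_def)
      then show ?thesis by (simp add: m_def)
    qed
  qed
  have AE: "AE \<xi> in lborel. exp (- \<xi>\<^sup>2 / 2) / max 1 \<bar>\<tau> * \<xi>\<bar> \<le> 2 * (1 + \<bar>\<tau>\<bar>) powr (\<epsilon> - 1) * w \<xi>" for \<tau> :: real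
    using AE_lborel_singleton[of 0] by eventually_elim (rule main)
  have int: "integrable lborel (\<lambda>\<xi>::real. exp (- \<xi>\<^sup>2 / 2) / max 1 \<bar>\<tau> * \<xi>\<bar>)" for \<tau>
  proof (rule Bochner_Integration.integrable_bound)
    show "integrable lborel (\<lambda>\<xi>. 2 * (1 + \<bar>\<tau>\<bar>) powr (\<epsilon> - 1) * w \<xi>)"
      using w_int by (intro integrable_mult_right)
    show "AE \<xi> in lborel. norm (exp (- \<xi>\<^sup>2 / 2) / max 1 \<bar>\<tau> * \<xi>\<bar>) \<le> norm (2 * (1 + \<bar>\<tau>\<bar>) powr (\<epsilon> - 1) * w \<xi>)"
      using AE[of \<tau>] by eventually_elim (use w_nonneg in simp)
  qed measurable
  have "(\<integral>\<xi>. exp (- \<xi>\<^sup>2 / 2) / max 1 \<bar>\<tau> * \<xi>\<bar> \<partial>lborel) \<le> (2 * (\<integral>\<xi>. w \<xi> \<partial>lborel) + 1) * (1 + \<bar>\<tau>\<bar>) powr (\<epsilon> - 1)" for \<tau>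
  proof -
    have "(\<integral>\<xi>. exp (- \<xi>\<^sup>2 / 2) / max 1 \<bar>\<tau> * \<xi>\<bar> \<partial>lborel) \<le> (\<integral>\<xi>. 2 * (1 + \<bar>\<tau>\<bar>) powr (\<epsilon> - 1) * w \<xi> \<partial>lborel)"
      using w_int by (intro integral_mono_AE int AE integrable_mult_right)
    also have "\<dots> = 2 * (1 + \<bar>\<tau>\<bar>) powr (\<epsilon> - 1) * (\<integral>\<xi>. w \<xi> \<partial>lborel)" by simp
    also have "\<dots> \<le> (2 * (\<integral>\<xi>. w \<xi> \<partial>lborel) + 1) * (1 + \<bar>\<tau>\<bar>) powr (\<epsilon> - 1)"
      by (simp add: algebra_simps)
    finally show ?thesis .
  qed
  moreover have "2 * (\<integral>\<xi>. w \<xi> \<partial>lborel) + 1 > 0"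
    by (intro add_nonneg_pos mult_nonneg_nonneg Bochner_Integration.integral_nonneg) (auto simp: w_nonneg)
  ultimately show ?thesis using int by blast
qed

section \<open>Pointwise bound for the propagator kernel\<close>

text \<open>
  The points at which the solution is evaluated are split as \<open>(t, y, z)\<close> and \<open>x\<close>, because the
  maximal function takes the supremum over the former and the \<open>L\<^sup>2\<close> norm in the latter.
\<close>

definition phase :: "real \<times> real \<times> real \<Rightarrow> real \<Rightarrow> R3 \<Rightarrow> real" where
  "phase p x \<xi> = fst p * \<omega> \<xi> + (x, snd p) \<bullet> \<xi>"

definition evolution :: "(R3 \<Rightarrow> complex) \<Rightarrow> real \<times> real \<times> real \<Rightarrow> real \<Rightarrow> complex" where
  "evolution f p x = (\<integral>\<xi>. cis (phase p x \<xi>) * f \<xi> \<partial>lborel)"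

text \<open>
  The convolution kernel of the propagator, cut off at frequency \<open>1 / sqrt a\<close>.  A Gaussian cut-off
  keeps all transverse integrals Gaussian and extends to complex \<open>\<xi>\<close>.
\<close>

definition kernel :: "real \<Rightarrow> real \<times> real \<times> real \<Rightarrow> real \<Rightarrow> complex" where
  "kernel a p x = (\<integral>\<xi>. cis (phase p x \<xi>) * complex_of_real (exp (- a * (norm \<xi>)\<^sup>2)) \<partial>lborel)"

lemma \<omega>_Pair: "\<omega> (\<xi>, q) = \<xi> * (\<xi>\<^sup>2 + (norm q)\<^sup>2)"
  by (cases q) (simp add: \<omega>_def norm_Pair)

lemma continuous_on_\<omega>: "continuous_on UNIV \<omega>"
  unfolding \<omega>_def case_prod_beta by (intro continuous_intros)

lemma continuous_on_phase [continuous_intros]: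
  assumes "continuous_on S p" "continuous_on S x" "continuous_on S \<xi>"
  shows "continuous_on S (\<lambda>s. phase (p s) (x s) (\<xi> s))"
  unfolding phase_def
  by (intro continuous_intros continuous_on_compose2[OF continuous_on_\<omega>] assms) auto

lemma borel_measurable_phase [measurable (raw)]:
  assumes [measurable]: "p \<in> M \<rightarrow>\<^sub>M borel" "x \<in> M \<rightarrow>\<^sub>M borel" "\<xi> \<in> M \<rightarrow>\<^sub>M borel"
  shows "(\<lambda>s. phase (p s) (x s) (\<xi> s)) \<in> borel_measurable M"
proof -
  have "continuous_on UNIV (\<lambda>s. phase (fst s) (fst (snd s)) (snd (snd s)))"
    by (intro continuous_intros)
  from borel_measurable_continuous_onI[OF this]
  have *: "(\<lambda>s. phase (fst s) (fst (snd s)) (snd (snd s))) \<in> borel_measurable borel" .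
  have "(\<lambda>s. (p s, x s, \<xi> s)) \<in> M \<rightarrow>\<^sub>M borel"
    by (intro borel_measurable_Pair assms)
  from measurable_compose[OF this *] show ?thesis by simp
qed

lemma borel_measurable_cis [measurable (raw)]:
  "f \<in> borel_measurable M \<Longrightarrow> (\<lambda>x. cis (f x)) \<in> borel_measurable M"
  by (erule measurable_compose) (intro borel_measurable_continuous_onI continuous_intros)

lemma phase_diff: "phase p x \<xi> - phase p' x' \<xi> = phase (p - p') (x - x') \<xi>"
  by (simp add: phase_def inner_Pair algebra_simps inner_diff_left inner_prod_def)

lemma integral_times_lborel:
  fixes f g :: "real \<Rightarrow> complex"
  assumes "integrable lborel f" "integrable lborel g"
  shows "(\<integral>q. f (fst q) * g (snd q) \<partial>lborel) = (\<integral>x. f x \<partial>lborel) * (\<integral>y. g y \<partial>lborel)"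
proof -
  have "(\<integral>q. f (fst q) * g (snd q) \<partial>lborel) = (\<integral>(x, y). f x * g y \<partial>(lborel \<Otimes>\<^sub>M lborel))"
    by (simp add: lborel_prod case_prod_beta')
  also have "\<dots> = (\<integral>x. (\<integral>y. f x * g y \<partial>lborel) \<partial>lborel)"
    by (rule lborel_pair.integral_fst[symmetric]) (rule lborel_pair.integrable_times[OF assms])
  also have "\<dots> = (\<integral>x. f x \<partial>lborel) * (\<integral>y. g y \<partial>lborel)"
    by simp
  finally show ?thesis .
qed

text \<open>
  Two mechanisms are combined.  Shifting the contour of the first frequency to
  \<open>Im \<xi> = \<sigma>\<close> with \<open>\<bar>\<sigma>\<bar>\<close> of size \<open>1 / (1 + \<bar>\<tau>\<bar>)\<close> gains \<open>exp (- x \<sigma>)\<close>; for such small \<open>\<sigma>\<close> the growth of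
  the cubic phase off the real axis is absorbed by the Gaussian cut-off.  Then the transverse
  frequencies are integrated by \<open>norm_integral_chirp_le\<close> with \<open>b = 1 - \<i> \<tau> \<zeta>\<close>, once for each of them,
  which gives the dispersive factor \<open>pi / norm b\<close>.
\<close>

lemma norm_kernel_le_integral:
  fixes \<tau> y z x :: real
  assumes int: "integrable lborel (\<lambda>\<xi>::real. exp (- \<xi>\<^sup>2 / 2) / max 1 \<bar>\<tau> * \<xi>\<bar>)"
  shows "norm (kernel 1 (\<tau>, y, z) x) \<le> 2 * pi * exp (1 / 4) * exp (- \<bar>x\<bar> / (6 * (1 + \<bar>\<tau>\<bar>)))
      * (\<integral>\<xi>. exp (- \<xi>\<^sup>2 / 2) / max 1 \<bar>\<tau> * \<xi>\<bar> \<partial>lborel)"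
proof -
  \<comment> \<open>The size of the shift guarantees \<open>\<bar>\<sigma>\<bar> + \<bar>\<tau> \<sigma>\<bar> \<le> 1 / 6\<close>, so that the term \<open>3 \<tau> \<sigma> \<xi>\<^sup>2\<close> coming
    from the cubic costs at most half of the Gaussian decay.  Its sign makes \<open>x \<sigma>\<close> nonnegative.\<close>
  define \<sigma> where "\<sigma> = sgn x / (6 * (1 + \<bar>\<tau>\<bar>))"
  have x\<sigma>: "x * \<sigma> = \<bar>x\<bar> / (6 * (1 + \<bar>\<tau>\<bar>))"
    by (simp add: \<sigma>_def abs_sgn)
  have \<sigma>_le: "\<bar>\<sigma>\<bar> \<le> 1 / (6 * (1 + \<bar>\<tau>\<bar>))"
    by (auto simp: \<sigma>_def abs_divide abs_sgn_eq)
  define F where "F q \<zeta> = exp (\<i> * (of_real \<tau> * \<zeta> ^ 3 + of_real x * \<zeta>) - \<zeta>\<^sup>2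
      + (\<i> * of_real \<tau> * \<zeta> - 1) * of_real ((norm q)\<^sup>2) + \<i> * of_real ((y, z) \<bullet> q))"
    for q :: "real \<times> real" and \<zeta> :: complex
  have small: "\<bar>r\<bar> \<le> 1 / 6 \<and> \<bar>\<tau> * r\<bar> \<le> 1 / 6" if "\<bar>r\<bar> \<le> \<bar>\<sigma>\<bar>" for r
  proof -
    have "(1 + \<bar>\<tau>\<bar>) * \<bar>r\<bar> \<le> (1 + \<bar>\<tau>\<bar>) * (1 / (6 * (1 + \<bar>\<tau>\<bar>)))"
      using that \<sigma>_le by (intro mult_left_mono) auto
    also have "\<dots> = 1 / 6" by (simp add: field_simps)
    finally have "\<bar>r\<bar> + \<bar>\<tau> * r\<bar> \<le> 1 / 6" by (simp add: algebra_simps abs_mult)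
    then show ?thesis using abs_ge_zero[of r] abs_ge_zero[of "\<tau> * r"] by linarith
  qed
  have F_bound: "norm (F q (of_real \<xi> + \<i> * of_real r))
      \<le> exp (1 / 4 - x * r) * (exp (- (1/2) * \<xi>\<^sup>2) * exp (- (1/2) * (norm q)\<^sup>2))"
    if r: "\<bar>r\<bar> \<le> \<bar>\<sigma>\<bar>" for q \<xi> r
  proof -
    have Re: "Re (\<i> * (of_real \<tau> * (of_real \<xi> + \<i> * of_real r) ^ 3 + of_real x * (of_real \<xi> + \<i> * of_real r))
        - (of_real \<xi> + \<i> * of_real r)\<^sup>2
        + (\<i> * of_real \<tau> * (of_real \<xi> + \<i> * of_real r) - 1) * of_real ((norm q)\<^sup>2) + \<i> * of_real ((y, z) \<bullet> q))
      = - 3 * (\<tau> * r) * \<xi>\<^sup>2 + (\<tau> * r) * r\<^sup>2 - x * r - \<xi>\<^sup>2 + r\<^sup>2 - (1 + \<tau> * r) * (norm q)\<^sup>2"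
      by (simp add: power2_eq_square power3_eq_cube algebra_simps)
    have "\<bar>r\<bar>\<^sup>2 \<le> (1 / 6)\<^sup>2" using small[OF r] by (intro power_mono) auto
    then have r2: "r\<^sup>2 \<le> 1 / 36" by (simp add: power2_eq_square)
    have t: "- (1 / 6) \<le> \<tau> * r" "\<tau> * r \<le> 1 / 6" using small[OF r] by auto
    have "(- 3 * (\<tau> * r)) * \<xi>\<^sup>2 \<le> (1 / 2) * \<xi>\<^sup>2" using t by (intro mult_right_mono) auto
    moreover have "(\<tau> * r) * r\<^sup>2 \<le> (1 / 6) * r\<^sup>2" using t by (intro mult_right_mono) auto
    moreover have "(1 / 2) * (norm q)\<^sup>2 \<le> (1 + \<tau> * r) * (norm q)\<^sup>2" using t by (intro mult_right_mono) auto
    ultimately have "- 3 * (\<tau> * r) * \<xi>\<^sup>2 + (\<tau> * r) * r\<^sup>2 - x * r - \<xi>\<^sup>2 + r\<^sup>2 - (1 + \<tau> * r) * (norm q)\<^sup>2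
        \<le> (1 / 4 - x * r) + (- (1/2) * \<xi>\<^sup>2 + - (1/2) * (norm q)\<^sup>2)"
      using r2 by argo
    then show ?thesis
      unfolding F_def norm_exp_eq_Re Re by (simp flip: exp_add)
  qed
  have F_meas [measurable]: "(\<lambda>s. F (g s) (h s)) \<in> borel_measurable M"
    if [measurable]: "g \<in> M \<rightarrow>\<^sub>M borel" "h \<in> M \<rightarrow>\<^sub>M borel" for g h and M :: "'m measure"
    unfolding F_def by measurable
  have F_int: "integrable (lborel \<Otimes>\<^sub>M lborel) (\<lambda>(\<xi>, q). F q (of_real \<xi> + \<i> * of_real r))"
    if r: "\<bar>r\<bar> \<le> \<bar>\<sigma>\<bar>" for r
  proof (rule Bochner_Integration.integrable_bound)
    have "integrable (lborel \<Otimes>\<^sub>M lborel) (\<lambda>(\<xi>::real, q::real\<times>real).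
        (exp (1 / 4 - x * r) * exp (- (1/2) * \<xi>\<^sup>2)) * exp (- (1/2) * (norm q)\<^sup>2))"
      by (intro lborel_pair.integrable_times integrable_mult_right integrable_gaussian integrable_gaussian_R2) auto
    then show "integrable (lborel \<Otimes>\<^sub>M lborel) (\<lambda>(\<xi>::real, q::real\<times>real).
        exp (1 / 4 - x * r) * (exp (- (1/2) * \<xi>\<^sup>2) * exp (- (1/2) * (norm q)\<^sup>2)))"
      by (simp add: mult.assoc)
    show "(\<lambda>(\<xi>, q). F q (of_real \<xi> + \<i> * of_real r)) \<in> borel_measurable (lborel \<Otimes>\<^sub>M lborel)"
      by measurable
    show "AE s in lborel \<Otimes>\<^sub>M lborel. norm (case s of (\<xi>, q) \<Rightarrow> F q (of_real \<xi> + \<i> * of_real r))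
        \<le> norm (case s of (\<xi>, q) \<Rightarrow> exp (1 / 4 - x * r) * (exp (- (1/2) * \<xi>\<^sup>2) * exp (- (1/2) * (norm q)\<^sup>2)))"
      using F_bound[OF r] by (intro AE_I2) (auto simp: abs_mult)
  qed
  have F_0: "F q (complex_of_real \<xi>) = cis (phase (\<tau>, y, z) x (\<xi>, q)) * of_real (exp (- 1 * (norm (\<xi>, q))\<^sup>2))" for \<xi> q
    unfolding F_def cis_conv_exp exp_of_real[symmetric] exp_add[symmetric]
    by (rule arg_cong[where f = exp])
       (simp add: phase_def \<omega>_Pair inner_Pair norm_Pair power2_eq_square power3_eq_cube algebra_simps
         flip: of_real_power)
  have "kernel 1 (\<tau>, y, z) x = (\<integral>(\<xi>, q). F q (of_real \<xi> + \<i> * of_real 0) \<partial>(lborel \<Otimes>\<^sub>M lborel))"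
    unfolding kernel_def by (simp add: lborel_prod case_prod_beta' F_0)
  also have "\<dots> = (\<integral>q. (\<integral>\<xi>. F q (of_real \<xi> + \<i> * of_real 0) \<partial>lborel) \<partial>lborel)"
    by (rule lborel_pair.integral_snd[symmetric, OF F_int]) simp
  also have "\<dots> = (\<integral>q. (\<integral>\<xi>. F q (of_real \<xi> + \<i> * of_real \<sigma>) \<partial>lborel) \<partial>lborel)"
  proof (rule Bochner_Integration.integral_cong[OF refl])
    fix q
    have "(\<integral>\<xi>. F q (of_real \<xi> + \<i> * of_real \<sigma>) \<partial>lborel) = (\<integral>\<xi>. F q (of_real \<xi>) \<partial>lborel)"
    proof (rule integral_shift_line[where \<alpha> = "1/2" and B = "exp (1 / 4 + \<bar>x\<bar> * \<bar>\<sigma>\<bar>)"])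
      show "F q holomorphic_on UNIV" unfolding F_def by (intro holomorphic_intros)
      fix \<xi> r :: real assume r: "\<bar>r\<bar> \<le> \<bar>\<sigma>\<bar>"
      have "- (x * r) \<le> \<bar>x * r\<bar>" by simp
      also have "\<dots> \<le> \<bar>x\<bar> * \<bar>\<sigma>\<bar>" using r by (simp add: abs_mult mult_left_mono)
      finally have "exp (1 / 4 - x * r) * (exp (- (1/2) * \<xi>\<^sup>2) * exp (- (1/2) * (norm q)\<^sup>2))
          \<le> exp (1 / 4 + \<bar>x\<bar> * \<bar>\<sigma>\<bar>) * (exp (- (1/2) * \<xi>\<^sup>2) * 1)"
        by (intro mult_mono) auto
      from order_trans[OF F_bound[OF r] this]
      show "norm (F q (of_real \<xi> + \<i> * of_real r)) \<le> exp (1 / 4 + \<bar>x\<bar> * \<bar>\<sigma>\<bar>) * exp (- (1/2) * \<xi>\<^sup>2)"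
        by (simp only: mult_1_right)
    qed simp
    then show "(\<integral>\<xi>. F q (of_real \<xi> + \<i> * of_real 0) \<partial>lborel) = (\<integral>\<xi>. F q (of_real \<xi> + \<i> * of_real \<sigma>) \<partial>lborel)"
      by simp
  qed
  also have "\<dots> = (\<integral>\<xi>. (\<integral>q. F q (of_real \<xi> + \<i> * of_real \<sigma>) \<partial>lborel) \<partial>lborel)"
    by (rule lborel_pair.Fubini_integral[OF F_int]) simp
  finally have kernel_eq: "kernel 1 (\<tau>, y, z) x = \<dots>" .
  have inner: "norm (\<integral>q. F q (of_real \<xi> + \<i> * of_real \<sigma>) \<partial>lborel)
      \<le> 2 * pi * exp (1 / 4 - x * \<sigma>) * (exp (- \<xi>\<^sup>2 / 2) / max 1 \<bar>\<tau> * \<xi>\<bar>)" for \<xi>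
  proof -
    define \<zeta> where "\<zeta> = complex_of_real \<xi> + \<i> * of_real \<sigma>"
    define b where "b = 1 - \<i> * of_real \<tau> * \<zeta>"
    have Re_b: "Re b = 1 + \<tau> * \<sigma>" and Im_b: "Im b = - \<tau> * \<xi>" by (auto simp: b_def \<zeta>_def)
    have t: "- (1 / 6) \<le> \<tau> * \<sigma>" using small[of \<sigma>] by auto
    then have b_pos: "Re b > 0" by (simp add: Re_b)
    have "max 1 \<bar>\<tau> * \<xi>\<bar> \<le> 2 * norm b"
      using abs_Re_le_cmod[of b] abs_Im_le_cmod[of b] t by (simp add: Re_b Im_b abs_mult)
    then have "2 / (2 * norm b) \<le> 2 / max 1 \<bar>\<tau> * \<xi>\<bar>"
    proof (rule divide_left_mono)
      have "norm b > 0" using b_pos by auto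
      then show "0 < (2 * norm b) * max 1 \<bar>\<tau> * \<xi>\<bar>" by (intro mult_pos_pos) auto
    qed simp_all
    then have b_ge: "1 / norm b \<le> 2 / max 1 \<bar>\<tau> * \<xi>\<bar>" by simp
    define c where "c v \<eta> = exp (- b * of_real (\<eta>\<^sup>2) + \<i> * of_real (v * \<eta>))" for v \<eta> :: real
    have c_int: "integrable lborel (c v)" for v
      unfolding c_def by (rule integrable_chirp[OF b_pos])
    have c_le: "(norm (\<integral>\<eta>. c v \<eta> \<partial>lborel))\<^sup>2 \<le> pi / norm b" for v
      unfolding c_def by (rule norm_integral_chirp_le[OF b_pos])
    define A where "A = \<i> * (of_real \<tau> * \<zeta> ^ 3 + of_real x * \<zeta>) - \<zeta>\<^sup>2"
    have F_0\<zeta>: "F 0 \<zeta> = exp A" by (simp add: F_def A_def)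
    have "F q \<zeta> = exp A * (c y (fst q) * c z (snd q))" for q
    proof -
      have n: "complex_of_real ((norm q)\<^sup>2) = of_real ((fst q)\<^sup>2) + of_real ((snd q)\<^sup>2)"
        by (cases q) (simp add: norm_Pair)
      have i: "complex_of_real ((y, z) \<bullet> q) = of_real (y * fst q) + of_real (z * snd q)"
        by (cases q) simp
      show ?thesis
        unfolding F_def c_def exp_add[symmetric] n i b_def A_def
        by (rule arg_cong[where f = exp]) (simp add: algebra_simps)
    qed
    then have "(\<integral>q. F q \<zeta> \<partial>lborel) = exp A * ((\<integral>\<eta>. c y \<eta> \<partial>lborel) * (\<integral>\<mu>. c z \<mu> \<partial>lborel))"
      by (simp add: integral_times_lborel[OF c_int c_int])
    then have "norm (\<integral>q. F q \<zeta> \<partial>lborel)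
        = norm (exp A) * (norm (\<integral>\<eta>. c y \<eta> \<partial>lborel) * norm (\<integral>\<mu>. c z \<mu> \<partial>lborel))"
      by (simp add: norm_mult)
    also have "\<dots> \<le> (exp (1 / 4 - x * \<sigma>) * exp (- \<xi>\<^sup>2 / 2)) * (pi / norm b)"
    proof (rule mult_mono)
      show "norm (exp A) \<le> exp (1 / 4 - x * \<sigma>) * exp (- \<xi>\<^sup>2 / 2)"
        unfolding F_0\<zeta>[symmetric] using F_bound[of \<sigma> 0 \<xi>] by (simp add: \<zeta>_def)
      have "(norm (\<integral>\<eta>. c y \<eta> \<partial>lborel) * norm (\<integral>\<mu>. c z \<mu> \<partial>lborel))\<^sup>2 \<le> (pi / norm b) * (pi / norm b)"
        unfolding power_mult_distrib by (intro mult_mono c_le) auto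
      then show "norm (\<integral>\<eta>. c y \<eta> \<partial>lborel) * norm (\<integral>\<mu>. c z \<mu> \<partial>lborel) \<le> pi / norm b"
        unfolding power2_eq_square[of "pi / norm b", symmetric]
        by (rule power2_le_imp_le) simp
    qed auto
    also have "\<dots> \<le> (exp (1 / 4 - x * \<sigma>) * exp (- \<xi>\<^sup>2 / 2)) * (pi * (2 / max 1 \<bar>\<tau> * \<xi>\<bar>))"
    proof (rule mult_left_mono)
      have "pi * (1 / norm b) \<le> pi * (2 / max 1 \<bar>\<tau> * \<xi>\<bar>)"
        using b_ge by (rule mult_left_mono) simp
      then show "pi / norm b \<le> pi * (2 / max 1 \<bar>\<tau> * \<xi>\<bar>)" by simp
    qed simp
    finally show ?thesis by (simp add: \<zeta>_def mult_ac)
  qed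
  have "norm (kernel 1 (\<tau>, y, z) x) \<le> (\<integral>\<xi>. norm (\<integral>q. F q (of_real \<xi> + \<i> * of_real \<sigma>) \<partial>lborel) \<partial>lborel)"
    unfolding kernel_eq by (rule integral_norm_bound)
  also have "\<dots> \<le> (\<integral>\<xi>. 2 * pi * exp (1 / 4 - x * \<sigma>) * (exp (- \<xi>\<^sup>2 / 2) / max 1 \<bar>\<tau> * \<xi>\<bar>) \<partial>lborel)"
    by (intro integral_mono integrable_norm lborel_pair.integrable_fst[OF F_int] integrable_mult_right int inner) simp
  also have "\<dots> = 2 * pi * exp (1 / 4 - x * \<sigma>) * (\<integral>\<xi>. exp (- \<xi>\<^sup>2 / 2) / max 1 \<bar>\<tau> * \<xi>\<bar> \<partial>lborel)"
    by (rule integral_mult_right_zero)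
  also have "exp (1 / 4 - x * \<sigma>) = exp (1 / 4) * exp (- \<bar>x\<bar> / (6 * (1 + \<bar>\<tau>\<bar>)))"
    unfolding x\<sigma> by (simp flip: exp_add)
  finally show ?thesis by (simp add: mult_ac)
qed

text \<open>
  The weak exponential localisation \<open>exp (- \<bar>x\<bar> / (6 (1 + \<bar>\<tau>\<bar>)))\<close> is worth \<open>(1 + \<bar>\<tau>\<bar>) powr (1 + \<epsilon>)\<close> times
  an integrable power of \<open>x\<close>; the dispersive decay \<open>(1 + \<bar>\<tau>\<bar>) powr (\<epsilon> - 1)\<close> pays for all of this up to
  the small power \<open>2 \<epsilon>\<close>.  The result is monotone in \<open>\<bar>\<tau>\<bar>\<close>, so it survives a supremum over bounded
  times.
\<close>

lemma kernel_bound: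
  assumes "0 < \<epsilon>" "\<epsilon> < 1"
  obtains C where "C > 0"
    "\<And>p x. norm (kernel 1 p x) \<le> C * (1 + \<bar>fst p\<bar>) powr (2 * \<epsilon>) * (1 + \<bar>x\<bar>) powr (- 1 - \<epsilon>)"
proof -
  obtain C where C: "C > 0"
    and int: "\<And>\<tau>. integrable lborel (\<lambda>\<xi>::real. exp (- \<xi>\<^sup>2 / 2) / max 1 \<bar>\<tau> * \<xi>\<bar>)"
    and le: "\<And>\<tau>. (\<integral>\<xi>. exp (- \<xi>\<^sup>2 / 2) / max 1 \<bar>\<tau> * \<xi>\<bar> \<partial>lborel) \<le> C * (1 + \<bar>\<tau>\<bar>) powr (\<epsilon> - 1)"
    using integral_inverse_max_gaussian_le[OF assms] by blast
  show thesis
  proof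
    show "2 * pi * exp (1 / 4) * 144 * C > 0" using C by simp
    fix p :: "real \<times> real \<times> real" and x :: real
    obtain \<tau> y z where p: "p = (\<tau>, y, z)" by (cases p) auto
    define m where "m = 1 + \<bar>\<tau>\<bar>"
    have m: "m \<ge> 1" by (simp add: m_def)
    define u where "u = \<bar>x\<bar> / m"
    have u: "u \<ge> 0" using m by (simp add: u_def)
    have "(1 + u) / 12 \<le> 1 + u / 12" by simp
    also have "\<dots> \<le> exp (u / 12)" by (rule exp_ge_add_one_self)
    finally have "((1 + u) / 12)\<^sup>2 \<le> (exp (u / 12))\<^sup>2" using u by (intro power_mono) auto
    then have "(1 + u)\<^sup>2 \<le> 144 * exp (u / 6)"
      by (simp add: power_divide flip: exp_double)
    then have "exp (- u / 6) \<le> 144 * (1 / (1 + u)\<^sup>2)"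
      using u by (simp add: exp_minus field_simps)
    also have "1 / (1 + u)\<^sup>2 = (1 + u) powr (- 2)"
      using u by (simp add: powr_minus_divide)
    also have "144 * (1 + u) powr (- 2) \<le> 144 * (1 + u) powr (- 1 - \<epsilon>)"
      using u assms by (intro mult_left_mono powr_mono) auto
    finally have e: "exp (- u / 6) \<le> 144 * (1 + u) powr (- 1 - \<epsilon>)" .
    have "(1 + \<bar>x\<bar>) / m \<le> 1 + u"
      using m by (simp add: u_def add_divide_distrib)
    then have "(1 + u) powr (- 1 - \<epsilon>) \<le> ((1 + \<bar>x\<bar>) / m) powr (- 1 - \<epsilon>)"
      using m assms by (intro powr_mono2') auto
    also have "\<dots> = (1 + \<bar>x\<bar>) powr (- 1 - \<epsilon>) * m powr (1 + \<epsilon>)"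
    proof -
      have "m powr (- 1 - \<epsilon>) = 1 / m powr (1 + \<epsilon>)"
        using powr_minus_divide[of m "1 + \<epsilon>"] by simp
      with m show ?thesis by (simp add: powr_divide)
    qed
    finally have e': "exp (- u / 6) \<le> 144 * ((1 + \<bar>x\<bar>) powr (- 1 - \<epsilon>) * m powr (1 + \<epsilon>))"
      using e by linarith
    have "norm (kernel 1 p x) \<le> 2 * pi * exp (1 / 4) * exp (- u / 6) * (C * m powr (\<epsilon> - 1))"
      unfolding p
      by (rule order_trans[OF norm_kernel_le_integral[OF int]])
         (use le[of \<tau>] in \<open>simp add: m_def u_def mult_left_mono field_simps\<close>)
    also have "\<dots> \<le> 2 * pi * exp (1 / 4) * (144 * ((1 + \<bar>x\<bar>) powr (- 1 - \<epsilon>) * m powr (1 + \<epsilon>))) * (C * m powr (\<epsilon> - 1))"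
      using e' C by (intro mult_right_mono mult_left_mono) auto
    also have "\<dots> = 2 * pi * exp (1 / 4) * 144 * C * (m powr (1 + \<epsilon>) * m powr (\<epsilon> - 1)) * (1 + \<bar>x\<bar>) powr (- 1 - \<epsilon>)"
      by (simp only: mult_ac)
    also have "m powr (1 + \<epsilon>) * m powr (\<epsilon> - 1) = m powr (2 * \<epsilon>)"
      by (simp flip: powr_add)
    finally show "norm (kernel 1 p x) \<le> 2 * pi * exp (1 / 4) * 144 * C * (1 + \<bar>fst p\<bar>) powr (2 * \<epsilon>) * (1 + \<bar>x\<bar>) powr (- 1 - \<epsilon>)"
      by (simp add: p m_def)
  qed
qed

lemma lborel_integral_scale:
  fixes f :: "'a::euclidean_space \<Rightarrow> complex"
  assumes [measurable]: "f \<in> borel_measurable borel" and "c > 0"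
  shows "(\<integral>x. f x \<partial>lborel) = c ^ DIM('a) *\<^sub>R (\<integral>x. f (c *\<^sub>R x) \<partial>lborel)"
proof -
  have "(\<integral>x. f x \<partial>lborel) = (\<integral>x. f x \<partial>density (distr lborel borel (\<lambda>x::'a. 0 + c *\<^sub>R x)) (\<lambda>_. ennreal (\<bar>c\<bar> ^ DIM('a))))"
    using \<open>c > 0\<close> by (subst lborel_affine[of c 0]) auto
  also have "\<dots> = c ^ DIM('a) *\<^sub>R (\<integral>x. f (c *\<^sub>R x) \<partial>lborel)"
    using \<open>c > 0\<close> by (simp add: integral_density integral_distr)
  finally show ?thesis .
qed

lemma phase_scale: "phase (t, v) x (c *\<^sub>R \<xi>) = phase (c ^ 3 * t, c *\<^sub>R v) (c * x) \<xi>"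
  by (cases v; cases \<xi>) (simp add: phase_def \<omega>_def inner_Pair power2_eq_square power3_eq_cube algebra_simps)

text \<open>
  The symbol is homogeneous of degree three, so the kernel with frequencies up to \<open>c\<close> is the one with
  unit frequencies at times longer by the factor \<open>c ^ 3\<close>.
\<close>

lemma kernel_scale:
  assumes "c > 0"
  shows "kernel (1 / c\<^sup>2) (t, v) x = c ^ 3 *\<^sub>R kernel 1 (c ^ 3 * t, c *\<^sub>R v) (c * x)"
proof -
  have "kernel (1 / c\<^sup>2) (t, v) x = c ^ DIM(R3) *\<^sub>R
     (\<integral>\<xi>. cis (phase (t, v) x (c *\<^sub>R \<xi>)) * complex_of_real (exp (- (1 / c\<^sup>2) * (norm (c *\<^sub>R \<xi>))\<^sup>2)) \<partial>lborel)"
    unfolding kernel_def using assms by (intro lborel_integral_scale) measurable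
  moreover have "- (1 / c\<^sup>2) * (norm (c *\<^sub>R \<xi>))\<^sup>2 = - 1 * (norm \<xi>)\<^sup>2" for \<xi> :: R3
    using assms by (simp add: power_mult_distrib)
  ultimately show ?thesis
    unfolding kernel_def phase_scale by (simp add: numeral_eq_Suc)
qed

lemma nn_integral_one_plus_abs_powr:
  fixes \<epsilon> :: real
  assumes "\<epsilon> > 0"
  shows "(\<integral>\<^sup>+x. ennreal ((1 + \<bar>x\<bar>) powr (- 1 - \<epsilon>)) \<partial>lborel) \<le> ennreal (2 / \<epsilon>)"
proof -
  define g where "g x = ennreal ((1 + x) powr (- 1 - \<epsilon>)) * indicator {0..} x" for x :: real
  define F where "F x = - ((1 + x) powr (- \<epsilon>)) / \<epsilon>" for x :: real
  have "(\<integral>\<^sup>+x. g x \<partial>lborel) = ennreal (0 - F 0)"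
    unfolding g_def
  proof (rule nn_integral_FTC_atLeast)
    fix x :: real assume x: "0 \<le> x"
    have "((\<lambda>x. (1 + x) powr (- \<epsilon>)) has_field_derivative (- \<epsilon> * (1 + x) powr (- \<epsilon> - 1)) * 1) (at x)"
      using x by (intro DERIV_chain2[OF has_real_derivative_powr]) (auto intro!: derivative_eq_intros)
    from DERIV_cdivide[OF DERIV_minus[OF this], of \<epsilon>]
    show "(F has_field_derivative (1 + x) powr (- 1 - \<epsilon>)) (at x)"
      unfolding F_def using assms by (simp add: minus_diff_commute)
  next
    have "((\<lambda>x. (1 + x) powr (- \<epsilon>)) \<longlongrightarrow> 0) at_top"
      using assms
      by (intro tendsto_neg_powr filterlim_tendsto_add_at_top[OF tendsto_const filterlim_ident]) simp
    from tendsto_divide_zero[OF tendsto_minus[OF this, unfolded minus_zero]]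
    show "(F \<longlongrightarrow> 0) at_top"
      unfolding F_def .
  qed auto
  then have g1: "(\<integral>\<^sup>+x. g x \<partial>lborel) = ennreal (1 / \<epsilon>)" by (simp add: F_def)
  have [measurable]: "g \<in> borel_measurable borel" unfolding g_def by measurable
  have g2: "(\<integral>\<^sup>+x. g (- x) \<partial>lborel) = ennreal (1 / \<epsilon>)"
    using nn_integral_real_affine[of g "-1" 0] g1 by simp
  have "(\<integral>\<^sup>+x. ennreal ((1 + \<bar>x\<bar>) powr (- 1 - \<epsilon>)) \<partial>lborel) \<le> (\<integral>\<^sup>+x. g x + g (- x) \<partial>lborel)"
    by (intro nn_integral_mono) (auto simp: g_def split: split_indicator)
  also have "\<dots> = ennreal (1 / \<epsilon>) + ennreal (1 / \<epsilon>)"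
    by (subst nn_integral_add) (simp_all add: g1 g2)
  also have "\<dots> = ennreal (2 / \<epsilon>)"
    using assms by (subst ennreal_plus[symmetric]) (simp_all add: field_simps)
  finally show ?thesis .
qed

section \<open>The adjoint of the linearised maximal operator\<close>

text \<open>
  The transpose of \<open>f \<mapsto> (\<lambda>x. evolution f (p x) x)\<close>.  The function \<open>p\<close> selects, for every \<open>x\<close>, the
  point \<open>(t, y, z)\<close> at which the solution is observed; it linearises the maximal function.
\<close>

definition evolution_adjoint :: "(real \<Rightarrow> real \<times> real \<times> real) \<Rightarrow> (real \<Rightarrow> complex) \<Rightarrow> R3 \<Rightarrow> complex" where
  "evolution_adjoint p h \<xi> = (\<integral>x. cis (phase (p x) x \<xi>) * h x \<partial>lborel)"

lemma integrable_cis_times: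
  fixes h :: "'a \<Rightarrow> complex"
  assumes "integrable M h" and [measurable]: "\<theta> \<in> borel_measurable M"
  shows "integrable M (\<lambda>x. cis (\<theta> x) * h x)"
  by (rule Bochner_Integration.integrable_bound[OF assms(1)]) (use assms(1) in \<open>auto simp: norm_mult\<close>)

lemma borel_measurable_fst_snd [measurable (raw)]:
  fixes f :: "'m \<Rightarrow> 'a::second_countable_topology \<times> 'b::second_countable_topology"
  assumes "f \<in> borel_measurable M"
  shows "(\<lambda>x. fst (f x)) \<in> borel_measurable M" "(\<lambda>x. snd (f x)) \<in> borel_measurable M"
  by (rule measurable_compose[OF assms], intro borel_measurable_continuous_onI continuous_intros)+

text \<open>
  The \<open>TT\<^sup>*\<close> step.  Expanding the square and integrating in \<open>\<xi>\<close> first gives the quadratic form of \<open>h\<close>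
  with kernel \<open>kernel a (p x - p x') (x - x')\<close>.  A majorant \<open>H\<close> of the kernel that depends on \<open>x - x'\<close>
  alone removes the unknown function \<open>p\<close>, and Young's inequality concludes.
\<close>

lemma evolution_adjoint_gaussian_bound:
  fixes p :: "real \<Rightarrow> real \<times> real \<times> real" and h :: "real \<Rightarrow> complex" and H :: "real \<Rightarrow> real"
  assumes [measurable]: "p \<in> borel_measurable borel" and h: "integrable lborel h" and a: "a > 0"
    and [measurable]: "H \<in> borel_measurable borel"
    and H: "\<And>x x'. norm (kernel a (p x - p x') (x - x')) \<le> H (x - x')"
  shows "(\<integral>\<^sup>+\<xi>. ennreal ((norm (evolution_adjoint p h \<xi>))\<^sup>2 * exp (- a * (norm \<xi>)\<^sup>2)) \<partial>lborel)
    \<le> (\<integral>\<^sup>+x. ennreal (H x) \<partial>lborel) * (\<integral>\<^sup>+x. ennreal ((norm (h x))\<^sup>2) \<partial>lborel)"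
proof -
  have [measurable]: "h \<in> borel_measurable borel" using h by auto
  define e where "e \<xi> = exp (- a * (norm \<xi>)\<^sup>2)" for \<xi> :: R3
  have e_int: "integrable lborel e" unfolding e_def using a by (rule integrable_gaussian_R3)
  have [measurable]: "e \<in> borel_measurable borel" using e_int by auto
  define g where "g \<xi> x = cis (phase (p x) x \<xi>) * h x" for \<xi> x
  have [measurable]: "(\<lambda>s. g (f1 s) (f2 s)) \<in> borel_measurable M"
    if [measurable]: "f1 \<in> M \<rightarrow>\<^sub>M borel" "f2 \<in> M \<rightarrow>\<^sub>M borel" for f1 f2 and M :: "'m measure"
    unfolding g_def by measurable
  have g_int: "integrable lborel (g \<xi>)" for \<xi>
    unfolding g_def by (intro integrable_cis_times h) measurable
  define G where "G \<xi> q = complex_of_real (e \<xi>) * (g \<xi> (fst q) * cnj (g \<xi> (snd q)))" for \<xi> and q :: "real \<times> real"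
  have hh: "integrable lborel (\<lambda>q::real\<times>real. norm (h (fst q)) * norm (h (snd q)))"
    using lborel_pair.integrable_times[OF integrable_norm[OF h] integrable_norm[OF h]]
    by (simp add: lborel_prod case_prod_beta')
  have G_int: "integrable (lborel \<Otimes>\<^sub>M lborel) (\<lambda>(\<xi>, q). G \<xi> q)"
  proof (rule Bochner_Integration.integrable_bound)
    show "integrable (lborel \<Otimes>\<^sub>M lborel) (\<lambda>(\<xi>::R3, q::real\<times>real). e \<xi> * (norm (h (fst q)) * norm (h (snd q))))"
      by (intro lborel_pair.integrable_times e_int hh)
    show "(\<lambda>(\<xi>, q). G \<xi> q) \<in> borel_measurable (lborel \<Otimes>\<^sub>M lborel)"
      unfolding G_def g_def by measurable
  qed (auto simp: G_def g_def norm_mult e_def)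
  have G_adj: "(\<integral>q. G \<xi> q \<partial>lborel) = complex_of_real ((norm (evolution_adjoint p h \<xi>))\<^sup>2 * e \<xi>)" for \<xi>
  proof -
    have "(\<integral>q. G \<xi> q \<partial>lborel) = complex_of_real (e \<xi>) * ((\<integral>x. g \<xi> x \<partial>lborel) * (\<integral>x. cnj (g \<xi> x) \<partial>lborel))"
      unfolding G_def by (subst integral_mult_right_zero, subst integral_times_lborel)
         (use g_int in auto)
    also have "\<dots> = complex_of_real (e \<xi>) * (evolution_adjoint p h \<xi> * cnj (evolution_adjoint p h \<xi>))"
      unfolding Bochner_Integration.integral_cnj by (simp only: evolution_adjoint_def g_def)
    finally show ?thesis by (simp only: of_real_mult complex_norm_square mult_ac)
  qed
  have G_kernel: "(\<integral>\<xi>. G \<xi> q \<partial>lborel) = kernel a (p (fst q) - p (snd q)) (fst q - snd q) * (h (fst q) * cnj (h (snd q)))" for q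
  proof -
    have "G \<xi> q = (cis (phase (p (fst q) - p (snd q)) (fst q - snd q) \<xi>) * complex_of_real (e \<xi>)) * (h (fst q) * cnj (h (snd q)))" for \<xi>
    proof -
      have "cis (u - v) = cis u * cnj (cis v)" for u v
        by (simp add: cis_cnj cis_mult)
      then show ?thesis by (simp only: G_def g_def phase_diff[symmetric] complex_cnj_mult mult_ac)
    qed
    then show ?thesis by (simp add: kernel_def e_def)
  qed
  have "integrable lborel (\<lambda>\<xi>. complex_of_real ((norm (evolution_adjoint p h \<xi>))\<^sup>2 * e \<xi>))"
    using lborel_pair.integrable_fst[OF G_int] by (simp add: G_adj)
  then have adj_int: "integrable lborel (\<lambda>\<xi>. (norm (evolution_adjoint p h \<xi>))\<^sup>2 * e \<xi>)"
    by (simp only: complex_of_real_integrable_eq)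
  have "(\<integral>\<^sup>+\<xi>. ennreal ((norm (evolution_adjoint p h \<xi>))\<^sup>2 * e \<xi>) \<partial>lborel) = ennreal (\<integral>\<xi>. (norm (evolution_adjoint p h \<xi>))\<^sup>2 * e \<xi> \<partial>lborel)"
    by (rule nn_integral_eq_integral[OF adj_int]) (simp add: e_def)
  also have "(\<integral>\<xi>. (norm (evolution_adjoint p h \<xi>))\<^sup>2 * e \<xi> \<partial>lborel) = norm (\<integral>\<xi>. (\<integral>q. G \<xi> q \<partial>lborel) \<partial>lborel)"
    unfolding G_adj integral_complex_of_real norm_of_real
    by (rule abs_of_nonneg[symmetric], rule Bochner_Integration.integral_nonneg) (simp add: e_def)
  also have "(\<integral>\<xi>. (\<integral>q. G \<xi> q \<partial>lborel) \<partial>lborel) = (\<integral>q. (\<integral>\<xi>. G \<xi> q \<partial>lborel) \<partial>lborel)"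
    by (rule lborel_pair.Fubini_integral[OF G_int, symmetric])
  also have "ennreal (norm \<dots>) \<le> (\<integral>\<^sup>+q. ennreal (norm (\<integral>\<xi>. G \<xi> q \<partial>lborel)) \<partial>lborel)"
    by (rule integral_norm_bound_ennreal[OF lborel_pair.integrable_snd[OF G_int]])
  also have "\<dots> \<le> (\<integral>\<^sup>+q. ennreal (H (fst q - snd q)) * ennreal ((norm (h (fst q)))\<^sup>2) / 2
        + ennreal (H (fst q - snd q)) * ennreal ((norm (h (snd q)))\<^sup>2) / 2 \<partial>lborel)"
  proof (rule nn_integral_mono)
    fix q :: "real \<times> real"
    have H0: "0 \<le> H (fst q - snd q)" using H[of "fst q" "snd q"] norm_ge_zero order_trans by blast
    have "norm (\<integral>\<xi>. G \<xi> q \<partial>lborel) \<le> H (fst q - snd q) * (norm (h (fst q)) * norm (h (snd q)))"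
      unfolding G_kernel norm_mult complex_mod_cnj by (intro mult_right_mono H) auto
    also have "\<dots> \<le> H (fst q - snd q) * (((norm (h (fst q)))\<^sup>2 + (norm (h (snd q)))\<^sup>2) / 2)"
      using sum_squares_bound[of "norm (h (fst q))" "norm (h (snd q))"]
      by (intro mult_left_mono H0) simp
    finally have "norm (\<integral>\<xi>. G \<xi> q \<partial>lborel) \<le>
        H (fst q - snd q) * (norm (h (fst q)))\<^sup>2 / 2 + H (fst q - snd q) * (norm (h (snd q)))\<^sup>2 / 2"
      by (simp add: field_simps)
    then have "ennreal (norm (\<integral>\<xi>. G \<xi> q \<partial>lborel)) \<le>
        ennreal (H (fst q - snd q) * (norm (h (fst q)))\<^sup>2 / 2 + H (fst q - snd q) * (norm (h (snd q)))\<^sup>2 / 2)"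
      by (rule ennreal_leI)
    also have "\<dots> = ennreal (H (fst q - snd q)) * ennreal ((norm (h (fst q)))\<^sup>2) / 2
        + ennreal (H (fst q - snd q)) * ennreal ((norm (h (snd q)))\<^sup>2) / 2"
    proof -
      have "ennreal (H (fst q - snd q) * b / 2) = ennreal (H (fst q - snd q)) * ennreal b / 2" if "b \<ge> 0" for b
        using divide_ennreal[of "H (fst q - snd q) * b" 2] H0 that by (simp add: ennreal_mult)
      then show ?thesis using H0 by (subst ennreal_plus) auto
    qed
    finally show "ennreal (norm (\<integral>\<xi>. G \<xi> q \<partial>lborel)) \<le> \<dots>" .
  qed
  also have "\<dots> = (\<integral>\<^sup>+q. ennreal (H (fst q - snd q)) * ennreal ((norm (h (fst q)))\<^sup>2) \<partial>lborel) / 2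
      + (\<integral>\<^sup>+q. ennreal (H (fst q - snd q)) * ennreal ((norm (h (snd q)))\<^sup>2) \<partial>lborel) / 2"
    by (subst nn_integral_add) (auto simp: nn_integral_divide)
  also have "(\<integral>\<^sup>+q. ennreal (H (fst q - snd q)) * ennreal ((norm (h (fst q)))\<^sup>2) \<partial>lborel)
      = (\<integral>\<^sup>+x. ennreal (H x) \<partial>lborel) * (\<integral>\<^sup>+x. ennreal ((norm (h x))\<^sup>2) \<partial>lborel)"
  proof -
    have "(\<integral>\<^sup>+q. ennreal (H (fst q - snd q)) * ennreal ((norm (h (fst q)))\<^sup>2) \<partial>lborel)
       = (\<integral>\<^sup>+x. (\<integral>\<^sup>+x'. ennreal (H (x - x')) * ennreal ((norm (h x))\<^sup>2) \<partial>lborel) \<partial>lborel)"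
      by (subst lborel_prod[symmetric], subst lborel.nn_integral_fst[symmetric]) auto
    also have "\<dots> = (\<integral>\<^sup>+x. (\<integral>\<^sup>+x'. ennreal (H x') \<partial>lborel) * ennreal ((norm (h x))\<^sup>2) \<partial>lborel)"
    proof (rule nn_integral_cong)
      fix x
      show "(\<integral>\<^sup>+x'. ennreal (H (x - x')) * ennreal ((norm (h x))\<^sup>2) \<partial>lborel)
          = (\<integral>\<^sup>+x'. ennreal (H x') \<partial>lborel) * ennreal ((norm (h x))\<^sup>2)"
        by (subst nn_integral_multc) (auto simp: nn_integral_real_affine[of "\<lambda>x. ennreal (H x)" "-1" x])
    qed
    also have "\<dots> = (\<integral>\<^sup>+x. ennreal (H x) \<partial>lborel) * (\<integral>\<^sup>+x. ennreal ((norm (h x))\<^sup>2) \<partial>lborel)"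
      by (rule nn_integral_cmult) auto
    finally show ?thesis .
  qed
  also have "(\<integral>\<^sup>+q. ennreal (H (fst q - snd q)) * ennreal ((norm (h (snd q)))\<^sup>2) \<partial>lborel)
      = (\<integral>\<^sup>+x. ennreal (H x) \<partial>lborel) * (\<integral>\<^sup>+x. ennreal ((norm (h x))\<^sup>2) \<partial>lborel)"
  proof -
    have "(\<integral>\<^sup>+q. ennreal (H (fst q - snd q)) * ennreal ((norm (h (snd q)))\<^sup>2) \<partial>lborel)
       = (\<integral>\<^sup>+x'. (\<integral>\<^sup>+x. ennreal (H (x - x')) * ennreal ((norm (h x'))\<^sup>2) \<partial>lborel) \<partial>lborel)"
      by (subst lborel_prod[symmetric], subst lborel_pair.nn_integral_snd[symmetric]) auto
    also have "\<dots> = (\<integral>\<^sup>+x'. (\<integral>\<^sup>+x. ennreal (H x) \<partial>lborel) * ennreal ((norm (h x'))\<^sup>2) \<partial>lborel)"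
    proof (rule nn_integral_cong)
      fix x'
      show "(\<integral>\<^sup>+x. ennreal (H (x - x')) * ennreal ((norm (h x'))\<^sup>2) \<partial>lborel)
          = (\<integral>\<^sup>+x. ennreal (H x) \<partial>lborel) * ennreal ((norm (h x'))\<^sup>2)"
        by (subst nn_integral_multc) (auto simp: nn_integral_real_affine[of "\<lambda>x. ennreal (H x)" 1 "- x'"])
    qed
    also have "\<dots> = (\<integral>\<^sup>+x. ennreal (H x) \<partial>lborel) * (\<integral>\<^sup>+x. ennreal ((norm (h x))\<^sup>2) \<partial>lborel)"
      by (rule nn_integral_cmult) auto
    finally show ?thesis .
  qed
  finally have "(\<integral>\<^sup>+\<xi>. ennreal ((norm (evolution_adjoint p h \<xi>))\<^sup>2 * e \<xi>) \<partial>lborel) \<le>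
      (\<integral>\<^sup>+x. ennreal (H x) \<partial>lborel) * (\<integral>\<^sup>+x. ennreal ((norm (h x))\<^sup>2) \<partial>lborel) / 2
      + (\<integral>\<^sup>+x. ennreal (H x) \<partial>lborel) * (\<integral>\<^sup>+x. ennreal ((norm (h x))\<^sup>2) \<partial>lborel) / 2" .
  moreover have "I / 2 + I / 2 = I" for I :: ennreal
  proof -
    have "I / 2 + I / 2 = I * 2 / 2" by (simp only: mult_2_right add_divide_distrib_ennreal)
    then show ?thesis using ennreal_mult_divide_eq[of 2 I] by simp
  qed
  ultimately show ?thesis
    by (simp only: e_def)
qed

text \<open>
  The single term with \<open>4 ^ k \<le> 1 + r\<^sup>2 < 4 ^ (k + 1)\<close> already dominates the weight: there
  \<open>r\<^sup>2 / 4 ^ k\<close> is below \<open>4\<close>, which is compensated by \<open>exp 4\<close>.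
\<close>

lemma powr_weight_le_suminf:
  fixes s r :: real
  assumes "s > 0"
  shows "ennreal ((1 + r\<^sup>2) powr (- s))
    \<le> (\<Sum>k. ennreal (exp 4 * 4 powr (- s * real k)) * ennreal (exp (- (1 / (2 ^ k)\<^sup>2) * r\<^sup>2)))"
proof -
  define k where "k = nat \<lfloor>log 4 (1 + r\<^sup>2)\<rfloor>"
  have log0: "0 \<le> log 4 (1 + r\<^sup>2)" by (subst zero_le_log_cancel_iff) (auto simp: add_pos_nonneg)
  have k: "real k \<le> log 4 (1 + r\<^sup>2)" "log 4 (1 + r\<^sup>2) < real k + 1"
    using log0 unfolding k_def by linarith+
  have pos: "0 < 1 + r\<^sup>2" by (simp add: add_pos_nonneg)
  have k1: "4 powr real k \<le> 1 + r\<^sup>2" using k(1) pos by (subst (asm) le_log_iff) auto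
  have k2: "1 + r\<^sup>2 < 4 powr (real k + 1)" using k(2) pos by (subst (asm) log_less_iff) auto
  have four: "4 powr real k = (2 ^ k)\<^sup>2"
    by (simp add: powr_realpow power2_eq_square flip: power_mult_distrib)
  have "(1 + r\<^sup>2) powr (- s) \<le> (4 powr real k) powr (- s)"
    using k1 assms by (intro powr_mono2') auto
  then have 1: "(1 + r\<^sup>2) powr (- s) \<le> 4 powr (- s * real k)"
    by (simp add: powr_powr mult.commute)
  have "r\<^sup>2 \<le> 4 * (2 ^ k)\<^sup>2" using k2 by (simp add: powr_add four)
  then have "1 \<le> exp 4 * exp (- (1 / (2 ^ k)\<^sup>2) * r\<^sup>2)"
    by (simp add: field_simps flip: exp_add)
  then have "(1 + r\<^sup>2) powr (- s) * 1 \<le> 4 powr (- s * real k) * (exp 4 * exp (- (1 / (2 ^ k)\<^sup>2) * r\<^sup>2))"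
    using 1 by (intro mult_mono) auto
  then have "ennreal ((1 + r\<^sup>2) powr (- s)) \<le> ennreal (exp 4 * 4 powr (- s * real k)) * ennreal (exp (- (1 / (2 ^ k)\<^sup>2) * r\<^sup>2))"
    by (subst ennreal_mult[symmetric]) (auto intro!: ennreal_leI simp: mult_ac)
  also have "\<dots> = (\<Sum>k\<in>{k}. ennreal (exp 4 * 4 powr (- s * real k)) * ennreal (exp (- (1 / (2 ^ k)\<^sup>2) * r\<^sup>2)))"
    by simp
  also have "\<dots> \<le> (\<Sum>k. ennreal (exp 4 * 4 powr (- s * real k)) * ennreal (exp (- (1 / (2 ^ k)\<^sup>2) * r\<^sup>2)))"
    by (rule sum_le_suminf) auto
  finally show ?thesis .
qed

text \<open>
  With \<open>\<rho>\<close> the frequency scale, the rescaled times are at most \<open>\<rho> ^ 3\<close>, which costs \<open>\<rho> powr (6 * \<epsilon>)\<close>.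
  The rest of the exponent is \<open>3\<close> from the scaling of the kernel minus \<open>1\<close> from the integration in
  \<open>\<rho> x\<close>.
\<close>

lemma evolution_adjoint_dyadic_bound:
  assumes "0 < \<epsilon>" "\<epsilon> < 1"
  obtains C where "C > 0"
    "\<And>p h \<rho>. \<lbrakk>p \<in> borel_measurable borel; \<And>x. 0 \<le> fst (p x) \<and> fst (p x) \<le> 1; integrable lborel h; \<rho> \<ge> 1\<rbrakk> \<Longrightarrow>
      (\<integral>\<^sup>+\<xi>. ennreal ((norm (evolution_adjoint p h \<xi>))\<^sup>2 * exp (- (1 / \<rho>\<^sup>2) * (norm \<xi>)\<^sup>2)) \<partial>lborel)
        \<le> ennreal (C * \<rho> powr (2 + 6 * \<epsilon>)) * (\<integral>\<^sup>+x. ennreal ((norm (h x))\<^sup>2) \<partial>lborel)"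
proof -
  obtain C where C: "C > 0"
    and kernel: "\<And>p x. norm (kernel 1 p x) \<le> C * (1 + \<bar>fst p\<bar>) powr (2 * \<epsilon>) * (1 + \<bar>x\<bar>) powr (- 1 - \<epsilon>)"
    using kernel_bound[OF assms] by blast
  define D where "D = C * 4 * (2 / \<epsilon>)"
  show thesis
  proof
    show "D > 0" using C assms by (simp add: D_def)
    fix p :: "real \<Rightarrow> real \<times> real \<times> real" and h :: "real \<Rightarrow> complex" and \<rho> :: real
    assume p: "p \<in> borel_measurable borel" and t: "\<And>x. 0 \<le> fst (p x) \<and> fst (p x) \<le> 1"
      and h: "integrable lborel h" and \<rho>: "\<rho> \<ge> 1"
    define B where "B = C * 4 * \<rho> powr (3 + 6 * \<epsilon>)"
    have B: "B \<ge> 0" using C by (simp add: B_def)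
    define H where "H x = B * (1 + \<bar>\<rho> * x\<bar>) powr (- 1 - \<epsilon>)" for x
    have H_meas [measurable]: "H \<in> borel_measurable borel" unfolding H_def by measurable
    have \<rho>_ge: "1 \<le> \<rho> ^ 3" using \<rho> by (rule one_le_power)
    have \<rho>_powr: "\<rho> ^ 3 = \<rho> powr 3" using \<rho> by (simp flip: powr_numeral)
    have K: "norm (kernel (1 / \<rho>\<^sup>2) (p x - p x') (x - x')) \<le> H (x - x')" for x x'
    proof -
      obtain t' v where d: "p x - p x' = (t', v)" by (cases "p x - p x'") auto
      have "t' = fst (p x) - fst (p x')" using d by (metis fst_conv fst_diff)
      then have "\<bar>t'\<bar> \<le> 1" using t[of x] t[of x'] by linarith
      then have "1 + \<bar>\<rho> ^ 3 * t'\<bar> \<le> 2 * \<rho> ^ 3"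
        using \<rho>_ge mult_left_mono[of "\<bar>t'\<bar>" 1 "\<rho> ^ 3"] unfolding abs_mult by linarith
      then have "(1 + \<bar>\<rho> ^ 3 * t'\<bar>) powr (2 * \<epsilon>) \<le> (2 * \<rho> powr 3) powr (2 * \<epsilon>)"
        using assms by (intro powr_mono2) (auto simp: \<rho>_powr)
      also have "\<dots> = 2 powr (2 * \<epsilon>) * \<rho> powr (6 * \<epsilon>)"
        using \<rho> by (simp add: powr_mult powr_powr del: powr_numeral)
      also have "\<dots> \<le> 4 * \<rho> powr (6 * \<epsilon>)"
        using powr_mono[of "2 * \<epsilon>" 2 2] assms by (intro mult_right_mono) auto
      finally have e: "(1 + \<bar>\<rho> ^ 3 * t'\<bar>) powr (2 * \<epsilon>) \<le> 4 * \<rho> powr (6 * \<epsilon>)" .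
      have "norm (kernel (1 / \<rho>\<^sup>2) (p x - p x') (x - x'))
         = \<rho> ^ 3 * norm (kernel 1 (\<rho> ^ 3 * t', \<rho> *\<^sub>R v) (\<rho> * (x - x')))"
        unfolding d using \<rho> by (simp add: kernel_scale)
      also have "\<dots> \<le> \<rho> ^ 3 * (C * (1 + \<bar>\<rho> ^ 3 * t'\<bar>) powr (2 * \<epsilon>) * (1 + \<bar>\<rho> * (x - x')\<bar>) powr (- 1 - \<epsilon>))"
        using kernel[of "(\<rho> ^ 3 * t', \<rho> *\<^sub>R v)" "\<rho> * (x - x')"] \<rho> by (intro mult_left_mono) auto
      also have "\<dots> \<le> \<rho> ^ 3 * (C * (4 * \<rho> powr (6 * \<epsilon>)) * (1 + \<bar>\<rho> * (x - x')\<bar>) powr (- 1 - \<epsilon>))"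
        using e C \<rho> by (intro mult_left_mono mult_right_mono) auto
      also have "\<dots> = H (x - x')"
        by (simp add: H_def B_def \<rho>_powr powr_add)
      finally show ?thesis .
    qed
    have HI: "(\<integral>\<^sup>+x. ennreal (H x) \<partial>lborel) \<le> ennreal (D * \<rho> powr (2 + 6 * \<epsilon>))"
    proof -
      define I where "I = (\<integral>\<^sup>+x. ennreal ((1 + \<bar>\<rho> * x\<bar>) powr (- 1 - \<epsilon>)) \<partial>lborel)"
      have "(\<integral>\<^sup>+x. ennreal ((1 + \<bar>x\<bar>) powr (- 1 - \<epsilon>)) \<partial>lborel) = ennreal \<rho> * I"
        unfolding I_def using \<rho> by (subst nn_integral_real_affine[of _ \<rho> 0]) auto
      then have "ennreal \<rho> * I \<le> ennreal (2 / \<epsilon>)"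
        using nn_integral_one_plus_abs_powr[of \<epsilon>] assms by simp
      have "(\<integral>\<^sup>+x. ennreal (H x) \<partial>lborel) = ennreal B * I"
        unfolding H_def I_def using B by (simp add: ennreal_mult' nn_integral_cmult)
      also have "ennreal B = ennreal (B / \<rho>) * ennreal \<rho>"
        using B \<rho> by (subst ennreal_mult[symmetric]) auto
      also have "ennreal (B / \<rho>) * ennreal \<rho> * I \<le> ennreal (B / \<rho>) * ennreal (2 / \<epsilon>)"
        unfolding mult.assoc by (rule mult_left_mono) (use \<open>ennreal \<rho> * I \<le> _\<close> in auto)
      also have "\<dots> = ennreal (D * \<rho> powr (2 + 6 * \<epsilon>))"
      proof -
        have "\<rho> powr (3 + 6 * \<epsilon>) = \<rho> powr (2 + 6 * \<epsilon>) * \<rho>"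
          using \<rho> powr_add[of \<rho> "2 + 6 * \<epsilon>" 1] by (simp add: add.commute add.left_commute)
        then have "B / \<rho> * (2 / \<epsilon>) = D * \<rho> powr (2 + 6 * \<epsilon>)"
          using \<rho> by (simp add: B_def D_def)
        moreover have "ennreal (B / \<rho>) * ennreal (2 / \<epsilon>) = ennreal (B / \<rho> * (2 / \<epsilon>))"
          using B \<rho> assms by (intro ennreal_mult[symmetric]) auto
        ultimately show ?thesis by simp
      qed
      finally show ?thesis .
    qed
    have "(\<integral>\<^sup>+\<xi>. ennreal ((norm (evolution_adjoint p h \<xi>))\<^sup>2 * exp (- (1 / \<rho>\<^sup>2) * (norm \<xi>)\<^sup>2)) \<partial>lborel)
        \<le> (\<integral>\<^sup>+x. ennreal (H x) \<partial>lborel) * (\<integral>\<^sup>+x. ennreal ((norm (h x))\<^sup>2) \<partial>lborel)"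
      by (rule evolution_adjoint_gaussian_bound[OF p h _ H_meas K]) (use \<rho> in auto)
    also have "\<dots> \<le> ennreal (D * \<rho> powr (2 + 6 * \<epsilon>)) * (\<integral>\<^sup>+x. ennreal ((norm (h x))\<^sup>2) \<partial>lborel)"
      by (rule mult_right_mono[OF HI]) simp
    finally show "(\<integral>\<^sup>+\<xi>. ennreal ((norm (evolution_adjoint p h \<xi>))\<^sup>2 * exp (- (1 / \<rho>\<^sup>2) * (norm \<xi>)\<^sup>2)) \<partial>lborel)
        \<le> ennreal (D * \<rho> powr (2 + 6 * \<epsilon>)) * (\<integral>\<^sup>+x. ennreal ((norm (h x))\<^sup>2) \<partial>lborel)" .
  qed
qed

text \<open>
  Summation over the scales \<open>\<rho> = 2 ^ k\<close>: the loss \<open>2 powr (k * (2 + 6 * \<epsilon>))\<close> is beaten by the weight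
  \<open>4 powr (- s * k)\<close> as soon as \<open>1 + 3 * \<epsilon> < s\<close>.  Here the assumption \<open>s > 1\<close> enters.
\<close>

lemma evolution_adjoint_sobolev_bound:
  fixes s :: real
  assumes "s > 1"
  obtains C where "C > 0"
    "\<And>p h. \<lbrakk>p \<in> borel_measurable borel; \<And>x. 0 \<le> fst (p x) \<and> fst (p x) \<le> 1; integrable lborel h\<rbrakk> \<Longrightarrow>
      (\<integral>\<^sup>+\<xi>. ennreal ((1 + (norm \<xi>)\<^sup>2) powr (- s)) * ennreal ((norm (evolution_adjoint p h \<xi>))\<^sup>2) \<partial>lborel)
        \<le> ennreal C * (\<integral>\<^sup>+x. ennreal ((norm (h x))\<^sup>2) \<partial>lborel)"
proof -
  define \<epsilon> where "\<epsilon> = min (1 / 2) ((s - 1) / 6)"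
  have \<epsilon>: "0 < \<epsilon>" "\<epsilon> < 1" "6 * \<epsilon> \<le> s - 1" using assms by (auto simp: \<epsilon>_def min_def)
  define q where "q = 2 powr (2 + 6 * \<epsilon> - 2 * s)"
  have q: "0 < q" "q < 1" using \<epsilon> assms by (auto simp: q_def powr_less_one)
  obtain C where C: "C > 0"
    and dyadic: "\<And>p h \<rho>. \<lbrakk>p \<in> borel_measurable borel; \<And>x. 0 \<le> fst (p x) \<and> fst (p x) \<le> 1; integrable lborel h; \<rho> \<ge> 1\<rbrakk> \<Longrightarrow>
      (\<integral>\<^sup>+\<xi>. ennreal ((norm (evolution_adjoint p h \<xi>))\<^sup>2 * exp (- (1 / \<rho>\<^sup>2) * (norm \<xi>)\<^sup>2)) \<partial>lborel)
        \<le> ennreal (C * \<rho> powr (2 + 6 * \<epsilon>)) * (\<integral>\<^sup>+x. ennreal ((norm (h x))\<^sup>2) \<partial>lborel)"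
    using evolution_adjoint_dyadic_bound[OF \<epsilon>(1,2)] by blast
  show thesis
  proof
    show "exp 4 * C * (1 / (1 - q)) > 0" using C q by simp
    fix p :: "real \<Rightarrow> real \<times> real \<times> real" and h :: "real \<Rightarrow> complex"
    assume p [measurable]: "p \<in> borel_measurable borel"
      and t: "\<And>x. 0 \<le> fst (p x) \<and> fst (p x) \<le> 1" and h: "integrable lborel h"
    have [measurable]: "h \<in> borel_measurable borel" using h by auto
    have [measurable]: "evolution_adjoint p h \<in> borel_measurable borel"
      unfolding evolution_adjoint_def by measurable
    define I where "I = (\<integral>\<^sup>+x. ennreal ((norm (h x))\<^sup>2) \<partial>lborel)"
    have "(\<integral>\<^sup>+\<xi>. ennreal ((1 + (norm \<xi>)\<^sup>2) powr (- s)) * ennreal ((norm (evolution_adjoint p h \<xi>))\<^sup>2) \<partial>lborel)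
      \<le> (\<integral>\<^sup>+\<xi>. (\<Sum>k. ennreal (exp 4 * 4 powr (- s * real k)) *
          ennreal ((norm (evolution_adjoint p h \<xi>))\<^sup>2 * exp (- (1 / (2 ^ k)\<^sup>2) * (norm \<xi>)\<^sup>2))) \<partial>lborel)"
    proof (rule nn_integral_mono)
      fix \<xi> :: R3
      have "ennreal ((1 + (norm \<xi>)\<^sup>2) powr (- s)) * ennreal ((norm (evolution_adjoint p h \<xi>))\<^sup>2) \<le>
        (\<Sum>k. ennreal (exp 4 * 4 powr (- s * real k)) * ennreal (exp (- (1 / (2 ^ k)\<^sup>2) * (norm \<xi>)\<^sup>2))) * ennreal ((norm (evolution_adjoint p h \<xi>))\<^sup>2)"
        using assms by (intro mult_right_mono powr_weight_le_suminf) auto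
      also have "\<dots> = (\<Sum>k. ennreal (exp 4 * 4 powr (- s * real k)) *
          ennreal ((norm (evolution_adjoint p h \<xi>))\<^sup>2 * exp (- (1 / (2 ^ k)\<^sup>2) * (norm \<xi>)\<^sup>2)))"
        unfolding ennreal_suminf_multc[symmetric]
        by (intro suminf_cong) (simp add: ennreal_mult mult_ac)
      finally show "ennreal ((1 + (norm \<xi>)\<^sup>2) powr (- s)) * ennreal ((norm (evolution_adjoint p h \<xi>))\<^sup>2) \<le> \<dots>" .
    qed
    also have "\<dots> = (\<Sum>k. ennreal (exp 4 * 4 powr (- s * real k)) *
        (\<integral>\<^sup>+\<xi>. ennreal ((norm (evolution_adjoint p h \<xi>))\<^sup>2 * exp (- (1 / (2 ^ k)\<^sup>2) * (norm \<xi>)\<^sup>2)) \<partial>lborel))"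
      by (subst nn_integral_suminf) (auto simp: nn_integral_cmult)
    also have "\<dots> \<le> (\<Sum>k. ennreal (exp 4 * C * q ^ k) * I)"
    proof (intro suminf_le summableI)
      fix k
      have "ennreal (exp 4 * 4 powr (- s * real k)) *
        (\<integral>\<^sup>+\<xi>. ennreal ((norm (evolution_adjoint p h \<xi>))\<^sup>2 * exp (- (1 / (2 ^ k)\<^sup>2) * (norm \<xi>)\<^sup>2)) \<partial>lborel)
        \<le> ennreal (exp 4 * 4 powr (- s * real k)) * (ennreal (C * (2 ^ k) powr (2 + 6 * \<epsilon>)) * I)"
        unfolding I_def by (intro mult_left_mono dyadic[OF p t h]) auto
      also have "\<dots> = ennreal ((exp 4 * 4 powr (- s * real k)) * (C * (2 ^ k) powr (2 + 6 * \<epsilon>))) * I"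
        using C by (subst ennreal_mult) (auto simp: mult.assoc)
      also have "(exp 4 * 4 powr (- s * real k)) * (C * (2 ^ k) powr (2 + 6 * \<epsilon>)) = exp 4 * C * q ^ k"
      proof -
        have "(4::real) powr (- s * real k) = (2 powr 2) powr (- s * real k)" by simp
        also have "\<dots> = 2 powr (real k * (- 2 * s))" unfolding powr_powr by (simp add: mult_ac)
        finally have 4: "(4::real) powr (- s * real k) = 2 powr (real k * (- 2 * s))" .
        have 2: "((2::real) ^ k) powr (2 + 6 * \<epsilon>) = 2 powr (real k * (2 + 6 * \<epsilon>))"
          by (simp add: powr_powr flip: powr_realpow)
        have "q ^ k = 2 powr (real k * (2 + 6 * \<epsilon> - 2 * s))"
          unfolding q_def by (simp add: powr_powr mult.commute flip: powr_realpow)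
        also have "\<dots> = 2 powr (real k * (- 2 * s)) * 2 powr (real k * (2 + 6 * \<epsilon>))"
          by (simp add: algebra_simps flip: powr_add)
        finally show ?thesis unfolding 4 2 by simp
      qed
      finally show "ennreal (exp 4 * 4 powr (- s * real k)) *
        (\<integral>\<^sup>+\<xi>. ennreal ((norm (evolution_adjoint p h \<xi>))\<^sup>2 * exp (- (1 / (2 ^ k)\<^sup>2) * (norm \<xi>)\<^sup>2)) \<partial>lborel)
        \<le> ennreal (exp 4 * C * q ^ k) * I" .
    qed
    also have "\<dots> = (\<Sum>k. ennreal (exp 4 * C * q ^ k)) * I"
      by simp
    also have "(\<Sum>k. ennreal (exp 4 * C * q ^ k)) = ennreal (exp 4 * C * (1 / (1 - q)))"
      using C q by (intro suminf_ennreal_eq sums_mult geometric_sums) auto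
    finally show "(\<integral>\<^sup>+\<xi>. ennreal ((1 + (norm \<xi>)\<^sup>2) powr (- s)) * ennreal ((norm (evolution_adjoint p h \<xi>))\<^sup>2) \<partial>lborel)
        \<le> ennreal (exp 4 * C * (1 / (1 - q))) * (\<integral>\<^sup>+x. ennreal ((norm (h x))\<^sup>2) \<partial>lborel)"
      by (simp add: I_def)
  qed
qed

section \<open>Duality and the maximal function\<close>

lemma U_eq_evolution:
  "U t \<phi> (x, v) = complex_of_real ((2 * pi) powr (- 3 / 2)) * evolution (fourier \<phi>) (t, v) x"
proof -
  have eq: "cis ((x, v) \<bullet> \<xi>) * (cis (t * \<omega> \<xi>) * fourier \<phi> \<xi>) = cis (phase (t, v) x \<xi>) * fourier \<phi> \<xi>" for \<xi>
    by (simp add: phase_def add.commute cis_mult flip: mult.assoc)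
  show ?thesis unfolding U_def inv_fourier_def evolution_def eq by simp
qed

lemma norm_evolution_le:
  "norm (evolution f p x) \<le> (\<integral>\<xi>. norm (f \<xi>) \<partial>lborel)"
  unfolding evolution_def by (rule order_trans[OF integral_norm_bound]) (simp add: norm_mult)

lemma borel_measurable_evolution [measurable (raw)]:
  assumes [measurable]: "f \<in> borel_measurable borel" "p \<in> borel_measurable borel"
  shows "(\<lambda>x. evolution f (p x) x) \<in> borel_measurable borel"
  unfolding evolution_def by measurable

text \<open>
  Duality.  Testing the linearised maximal function against its own conjugate \<open>h\<close> turns its squared
  norm \<open>N\<close> into the pairing of \<open>f\<close> with \<open>evolution_adjoint p h\<close>, and Cauchy-Schwarz with the weights
  \<open>w powr (s / 2)\<close> and \<open>w powr (- s / 2)\<close> gives \<open>N\<^sup>2 \<le> B C N\<close>.  The restriction to \<open>{- R..R}\<close> makes \<open>N\<close>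
  finite, so that one factor \<open>N\<close> can be cancelled.
\<close>

lemma linearised_maximal_bound:
  fixes s :: real
  assumes "s > 1"
  obtains C where "C > 0"
    "\<And>p f R. \<lbrakk>p \<in> borel_measurable borel; \<And>x. 0 \<le> fst (p x) \<and> fst (p x) \<le> 1; integrable lborel f\<rbrakk> \<Longrightarrow>
      (\<integral>\<^sup>+x. (ennreal (norm (evolution f (p x) x)))\<^sup>2 * indicator {- R..R} x \<partial>lborel)
        \<le> ennreal C * (\<integral>\<^sup>+\<xi>. (ennreal ((1 + (norm \<xi>)\<^sup>2) powr (s / 2) * norm (f \<xi>)))\<^sup>2 \<partial>lborel)"
proof -
  obtain C where C: "C > 0"
    and adj: "\<And>p h. \<lbrakk>p \<in> borel_measurable borel; \<And>x. 0 \<le> fst (p x) \<and> fst (p x) \<le> 1; integrable lborel h\<rbrakk> \<Longrightarrow>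
      (\<integral>\<^sup>+\<xi>. ennreal ((1 + (norm \<xi>)\<^sup>2) powr (- s)) * ennreal ((norm (evolution_adjoint p h \<xi>))\<^sup>2) \<partial>lborel)
        \<le> ennreal C * (\<integral>\<^sup>+x. ennreal ((norm (h x))\<^sup>2) \<partial>lborel)"
    using evolution_adjoint_sobolev_bound[OF assms] by blast
  show thesis
  proof
    show "C > 0" by fact
    fix p :: "real \<Rightarrow> real \<times> real \<times> real" and f :: "R3 \<Rightarrow> complex" and R :: real
    assume p [measurable]: "p \<in> borel_measurable borel"
      and t: "\<And>x. 0 \<le> fst (p x) \<and> fst (p x) \<le> 1" and f: "integrable lborel f"
    have f_meas [measurable]: "f \<in> borel_measurable borel" using f by auto
    define w where "w \<xi> = 1 + (norm \<xi>)\<^sup>2" for \<xi> :: R3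
    have w: "w \<xi> > 0" for \<xi> by (simp add: w_def add_pos_nonneg)
    have [measurable]: "w \<in> borel_measurable borel" unfolding w_def by measurable
    define B where "B = (\<integral>\<^sup>+\<xi>. (ennreal (w \<xi> powr (s / 2) * norm (f \<xi>)))\<^sup>2 \<partial>lborel)"
    define M where "M = (\<integral>\<xi>. norm (f \<xi>) \<partial>lborel)"
    have M0: "M \<ge> 0" by (simp add: M_def)
    define v where "v x = evolution f (p x) x" for x
    have [measurable]: "v \<in> borel_measurable borel" unfolding v_def by measurable
    have v_le: "norm (v x) \<le> M" for x unfolding v_def M_def by (rule norm_evolution_le)
    define h where "h x = indicator {- R..R} x *\<^sub>R cnj (v x)" for x
    have [measurable]: "h \<in> borel_measurable borel" unfolding h_def by measurable
    have h_int: "integrable lborel h"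
    proof (rule Bochner_Integration.integrable_bound)
      show "integrable lborel (\<lambda>x. M * indicator {- R..R} x)"
        by (intro integrable_mult_right integrable_real_indicator) (auto simp: emeasure_lborel_Icc_eq)
      show "AE x in lborel. norm (h x) \<le> norm (M * indicator {- R..R} x)"
        using v_le M0 by (intro AE_I2) (auto simp: h_def split: split_indicator)
    qed measurable
    have h2_int: "integrable lborel (\<lambda>x. (norm (h x))\<^sup>2)"
    proof (rule Bochner_Integration.integrable_bound)
      show "integrable lborel (\<lambda>x. M\<^sup>2 * indicator {- R..R} x)"
        by (intro integrable_mult_right integrable_real_indicator) (auto simp: emeasure_lborel_Icc_eq)
      show "AE x in lborel. norm ((norm (h x))\<^sup>2) \<le> norm (M\<^sup>2 * indicator {- R..R} x)"
        using v_le by (intro AE_I2) (auto simp: h_def split: split_indicator intro: power_mono)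
    qed measurable
    define N where "N = (\<integral>x. (norm (h x))\<^sup>2 \<partial>lborel)"
    have N0: "N \<ge> 0" by (simp add: N_def)
    have N_nn: "(\<integral>\<^sup>+x. ennreal ((norm (h x))\<^sup>2) \<partial>lborel) = ennreal N"
      unfolding N_def by (rule nn_integral_eq_integral[OF h2_int]) simp
    have vh: "v x * h x = complex_of_real ((norm (h x))\<^sup>2)" for x
      by (auto simp: h_def complex_norm_square[symmetric] split: split_indicator simp del: of_real_power)
    define K where "K x \<xi> = h x * f \<xi> * cis (phase (p x) x \<xi>)" for x \<xi>
    have K_int: "integrable (lborel \<Otimes>\<^sub>M lborel) (\<lambda>(x, \<xi>). K x \<xi>)"
    proof (rule Bochner_Integration.integrable_bound[OF lborel_pair.integrable_times[OF h_int f]])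
      show "(\<lambda>(x, \<xi>). K x \<xi>) \<in> borel_measurable (lborel \<Otimes>\<^sub>M lborel)"
        unfolding K_def by measurable
    qed (auto simp: K_def norm_mult)
    have K_fst: "(\<integral>\<xi>. K x \<xi> \<partial>lborel) = v x * h x" for x
      unfolding K_def v_def evolution_def by (simp only: mult.assoc integral_mult_right_zero)
        (simp only: mult_ac)
    have K_snd: "(\<integral>x. K x \<xi> \<partial>lborel) = f \<xi> * evolution_adjoint p h \<xi>" for \<xi>
      unfolding K_def evolution_adjoint_def by (simp only: integral_mult_right_zero[symmetric] mult_ac)
    have "complex_of_real N = (\<integral>x. (\<integral>\<xi>. K x \<xi> \<partial>lborel) \<partial>lborel)"
      unfolding K_fst vh N_def by (rule integral_complex_of_real[symmetric])
    also have "\<dots> = (\<integral>\<xi>. (\<integral>x. K x \<xi> \<partial>lborel) \<partial>lborel)"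
      by (rule lborel_pair.Fubini_integral[OF K_int, symmetric])
    finally have "ennreal N = ennreal (norm (\<integral>\<xi>. (\<integral>x. K x \<xi> \<partial>lborel) \<partial>lborel))"
      using N0 by (metis abs_of_nonneg norm_of_real)
    also have "\<dots> \<le> (\<integral>\<^sup>+\<xi>. ennreal (norm (\<integral>x. K x \<xi> \<partial>lborel)) \<partial>lborel)"
      by (rule integral_norm_bound_ennreal[OF lborel_pair.integrable_snd[OF K_int]])
    also have "\<dots> = (\<integral>\<^sup>+\<xi>. ennreal (w \<xi> powr (s / 2) * norm (f \<xi>)) * ennreal (w \<xi> powr (- s / 2) * norm (evolution_adjoint p h \<xi>)) \<partial>lborel)"
    proof (rule nn_integral_cong)
      fix \<xi>
      have "w \<xi> powr (s / 2) * w \<xi> powr (- s / 2) = 1"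
        using w[of \<xi>] by (simp flip: powr_add)
      then have "norm (f \<xi>) * norm (evolution_adjoint p h \<xi>)
          = (w \<xi> powr (s / 2) * norm (f \<xi>)) * (w \<xi> powr (- s / 2) * norm (evolution_adjoint p h \<xi>))"
        by (metis (no_types, opaque_lifting) mult.assoc mult.commute mult_1)
      then show "ennreal (norm (\<integral>x. K x \<xi> \<partial>lborel))
          = ennreal (w \<xi> powr (s / 2) * norm (f \<xi>)) * ennreal (w \<xi> powr (- s / 2) * norm (evolution_adjoint p h \<xi>))"
        unfolding K_snd by (simp add: norm_mult ennreal_mult[symmetric])
    qed
    finally have N_le: "ennreal N \<le> \<dots>" .
    have [measurable]: "evolution_adjoint p h \<in> borel_measurable borel"
      unfolding evolution_adjoint_def by measurable
    have "(\<integral>\<^sup>+\<xi>. (ennreal (w \<xi> powr (- s / 2) * norm (evolution_adjoint p h \<xi>)))\<^sup>2 \<partial>lborel)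
        = (\<integral>\<^sup>+\<xi>. ennreal (w \<xi> powr (- s)) * ennreal ((norm (evolution_adjoint p h \<xi>))\<^sup>2) \<partial>lborel)"
    proof (rule nn_integral_cong)
      fix \<xi>
      have "(w \<xi> powr (- s / 2))\<^sup>2 = w \<xi> powr (- s)"
        using w[of \<xi>] by (simp add: power2_eq_square flip: powr_add)
      then show "(ennreal (w \<xi> powr (- s / 2) * norm (evolution_adjoint p h \<xi>)))\<^sup>2
          = ennreal (w \<xi> powr (- s)) * ennreal ((norm (evolution_adjoint p h \<xi>))\<^sup>2)"
        by (simp add: ennreal_power power_mult_distrib ennreal_mult)
    qed
    also have "\<dots> \<le> ennreal C * ennreal N"
      using adj[OF p t h_int] unfolding N_nn w_def .
    finally have adj_le: "(\<integral>\<^sup>+\<xi>. (ennreal (w \<xi> powr (- s / 2) * norm (evolution_adjoint p h \<xi>)))\<^sup>2 \<partial>lborel) \<le> ennreal C * ennreal N" .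
    have "(ennreal N)\<^sup>2 \<le> (\<integral>\<^sup>+\<xi>. ennreal (w \<xi> powr (s / 2) * norm (f \<xi>)) * ennreal (w \<xi> powr (- s / 2) * norm (evolution_adjoint p h \<xi>)) \<partial>lborel)\<^sup>2"
      by (rule power_mono[OF N_le]) simp
    also have "\<dots> \<le> B * (\<integral>\<^sup>+\<xi>. (ennreal (w \<xi> powr (- s / 2) * norm (evolution_adjoint p h \<xi>)))\<^sup>2 \<partial>lborel)"
      unfolding B_def by (rule Cauchy_Schwarz_nn_integral) measurable
    also have "\<dots> \<le> B * (ennreal C * ennreal N)"
      by (rule mult_left_mono[OF adj_le]) simp
    finally have "ennreal N * ennreal N \<le> ennreal N * (ennreal C * B)"
      by (simp only: power2_eq_square mult_ac)
    then have "ennreal N \<le> ennreal C * B"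
      by (cases "ennreal N = 0") (auto simp: ennreal_mult_le_mult_iff)
    moreover have "(\<integral>\<^sup>+x. (ennreal (norm (evolution f (p x) x)))\<^sup>2 * indicator {- R..R} x \<partial>lborel) = ennreal N"
      unfolding N_nn[symmetric]
      by (rule nn_integral_cong) (auto simp: h_def v_def ennreal_power split: split_indicator)
    ultimately show "(\<integral>\<^sup>+x. (ennreal (norm (evolution f (p x) x)))\<^sup>2 * indicator {- R..R} x \<partial>lborel)
        \<le> ennreal C * (\<integral>\<^sup>+\<xi>. (ennreal ((1 + (norm \<xi>)\<^sup>2) powr (s / 2) * norm (f \<xi>)))\<^sup>2 \<partial>lborel)"
      by (simp add: B_def w_def)
  qed
qed

lemma measurable_argmax:
  fixes g :: "nat \<Rightarrow> 'a \<Rightarrow> real"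
  assumes [measurable]: "\<And>i. g i \<in> borel_measurable M"
  shows "\<exists>n. n \<in> M \<rightarrow>\<^sub>M count_space UNIV \<and> (\<forall>x. \<forall>i\<le>N. g i x \<le> g (n x) x)"
proof (induction N)
  case 0
  show ?case by (rule exI[of _ "\<lambda>_. 0"]) auto
next
  case (Suc N)
  then obtain n where n [measurable]: "n \<in> M \<rightarrow>\<^sub>M count_space UNIV" and le: "\<And>x i. i \<le> N \<Longrightarrow> g i x \<le> g (n x) x"
    by blast
  have [measurable]: "(\<lambda>x. g (n x) x) \<in> borel_measurable M"
    by (rule measurable_compose_countable) measurable
  define n' where "n' x = (if g (n x) x < g (Suc N) x then Suc N else n x)" for x
  have "n' \<in> M \<rightarrow>\<^sub>M count_space UNIV" unfolding n'_def by measurable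
  moreover have "g i x \<le> g (n' x) x" if "i \<le> Suc N" for i x
    using le[of i x] that by (cases "i = Suc N") (auto simp: n'_def)
  ultimately show ?case by blast
qed

lemma SUP_power2_ennreal:
  fixes a :: "nat \<Rightarrow> ennreal"
  shows "(SUP i. a i)\<^sup>2 \<le> (SUP i. (a i)\<^sup>2)"
proof -
  have "a i * a j \<le> (SUP i. (a i)\<^sup>2)" for i j
  proof (cases "a i \<le> a j")
    case True
    then have "a i * a j \<le> (a j)\<^sup>2" by (simp add: power2_eq_square mult_right_mono)
    also have "\<dots> \<le> (SUP i. (a i)\<^sup>2)" by (rule SUP_upper) simp
    finally show ?thesis .
  next
    case False
    then have "a i * a j \<le> (a i)\<^sup>2" by (simp add: power2_eq_square mult_left_mono)
    also have "\<dots> \<le> (SUP i. (a i)\<^sup>2)" by (rule SUP_upper) simp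
    finally show ?thesis .
  qed
  then show ?thesis
    unfolding power2_eq_square[of "SUP i. a i"] SUP_mult_left_ennreal SUP_mult_right_ennreal
    by (intro SUP_least)
qed

text \<open>
  For the maximum over the first \<open>N\<close> points of the sequence a measurable choice of the maximising point
  brings \<open>linearised_maximal_bound\<close> into play, with a constant independent of that choice; Fatou's
  lemma removes both the restriction to finitely many points and the one to \<open>\<bar>x\<bar> \<le> N\<close>.
\<close>

lemma maximal_bound:
  fixes s :: real
  assumes "s > 1"
  obtains C where "C > 0"
    "\<And>(q :: nat \<Rightarrow> real \<times> real \<times> real) f. \<lbrakk>\<And>n. 0 \<le> fst (q n) \<and> fst (q n) \<le> 1; integrable lborel f\<rbrakk> \<Longrightarrow>
      (\<integral>\<^sup>+x. (SUP n. ennreal (norm (evolution f (q n) x)))\<^sup>2 \<partial>lborel)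
        \<le> ennreal C * (\<integral>\<^sup>+\<xi>. (ennreal ((1 + (norm \<xi>)\<^sup>2) powr (s / 2) * norm (f \<xi>)))\<^sup>2 \<partial>lborel)"
proof -
  obtain C where C: "C > 0"
    and lin: "\<And>p f R. \<lbrakk>p \<in> borel_measurable borel; \<And>x. 0 \<le> fst (p x) \<and> fst (p x) \<le> 1; integrable lborel f\<rbrakk> \<Longrightarrow>
      (\<integral>\<^sup>+x. (ennreal (norm (evolution f (p x) x)))\<^sup>2 * indicator {- R..R} x \<partial>lborel)
        \<le> ennreal C * (\<integral>\<^sup>+\<xi>. (ennreal ((1 + (norm \<xi>)\<^sup>2) powr (s / 2) * norm (f \<xi>)))\<^sup>2 \<partial>lborel)"
    using linearised_maximal_bound[OF assms] by blast
  show thesis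
  proof
    show "C > 0" by fact
    fix q :: "nat \<Rightarrow> real \<times> real \<times> real" and f :: "R3 \<Rightarrow> complex"
    assume t: "\<And>n. 0 \<le> fst (q n) \<and> fst (q n) \<le> 1" and f: "integrable lborel f"
    have f_meas [measurable]: "f \<in> borel_measurable borel" using f by auto
    define B where "B = (\<integral>\<^sup>+\<xi>. (ennreal ((1 + (norm \<xi>)\<^sup>2) powr (s / 2) * norm (f \<xi>)))\<^sup>2 \<partial>lborel)"
    have "(\<lambda>x. norm (evolution f (q i) x)) \<in> borel_measurable borel" for i by measurable
    from measurable_argmax[of "\<lambda>i x. norm (evolution f (q i) x)", OF this]
    obtain m where m [measurable]: "\<And>N. m N \<in> borel \<rightarrow>\<^sub>M count_space UNIV"
      and max: "\<And>N x i. i \<le> N \<Longrightarrow> norm (evolution f (q i) x) \<le> norm (evolution f (q (m N x)) x)"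
      by metis
    have p [measurable]: "(\<lambda>x. q (m N x)) \<in> borel_measurable borel" for N
      by (rule measurable_compose[OF m]) simp
    define g where "g N x = (ennreal (norm (evolution f (q (m N x)) x)))\<^sup>2 * indicator {- real N..real N} x" for N x
    have [measurable]: "g N \<in> borel_measurable borel" for N unfolding g_def by measurable
    have g_le: "(\<integral>\<^sup>+x. g N x \<partial>lborel) \<le> ennreal C * B" for N
      unfolding g_def B_def by (rule lin[where p = "\<lambda>x. q (m N x)"]) (use t f p in auto)
    have "(\<integral>\<^sup>+x. (SUP n. ennreal (norm (evolution f (q n) x)))\<^sup>2 \<partial>lborel) \<le> (\<integral>\<^sup>+x. liminf (\<lambda>N. g N x) \<partial>lborel)"
    proof (rule nn_integral_mono)
      fix x
      have "(ennreal (norm (evolution f (q i) x)))\<^sup>2 \<le> liminf (\<lambda>N. g N x)" for i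
      proof (rule Liminf_bounded)
        show "\<forall>\<^sub>F N in sequentially. (ennreal (norm (evolution f (q i) x)))\<^sup>2 \<le> g N x"
          using eventually_ge_at_top[of i] eventually_ge_at_top[of "nat \<lceil>\<bar>x\<bar>\<rceil>"]
        proof eventually_elim
          case (elim N)
          have "\<bar>x\<bar> \<le> real N" using elim by linarith
          then have "x \<in> {- real N..real N}" by (auto simp: abs_le_iff)
          then show ?case using max[OF elim(1), of x] by (auto simp: g_def intro!: power_mono ennreal_leI)
        qed
      qed
      then show "(SUP n. ennreal (norm (evolution f (q n) x)))\<^sup>2 \<le> liminf (\<lambda>N. g N x)"
        by (intro order_trans[OF SUP_power2_ennreal] SUP_least)
    qed
    also have "\<dots> \<le> liminf (\<lambda>N. \<integral>\<^sup>+x. g N x \<partial>lborel)"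
      by (rule nn_integral_liminf) measurable
    also have "\<dots> \<le> ennreal C * B"
      using Liminf_mono[of "\<lambda>N. \<integral>\<^sup>+x. g N x \<partial>lborel" "\<lambda>_. ennreal C * B" sequentially] g_le
      by (simp add: Liminf_const)
    finally show "(\<integral>\<^sup>+x. (SUP n. ennreal (norm (evolution f (q n) x)))\<^sup>2 \<partial>lborel)
        \<le> ennreal C * (\<integral>\<^sup>+\<xi>. (ennreal ((1 + (norm \<xi>)\<^sup>2) powr (s / 2) * norm (f \<xi>)))\<^sup>2 \<partial>lborel)"
      by (simp add: B_def)
  qed
qed

lemma continuous_on_evolution:
  assumes "integrable lborel f"
  shows "continuous_on UNIV (\<lambda>p. evolution f p x)"
proof -
  have [measurable]: "f \<in> borel_measurable borel" using assms by auto
  have "(\<lambda>n. evolution f (P n) x) \<longlonglongrightarrow> evolution f p x" if P: "P \<longlonglongrightarrow> p" for P p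
    unfolding evolution_def
  proof (rule integral_dominated_convergence)
    show "integrable lborel (\<lambda>\<xi>. norm (f \<xi>))" using assms by (rule integrable_norm)
    show "AE \<xi> in lborel. (\<lambda>n. cis (phase (P n) x \<xi>) * f \<xi>) \<longlonglongrightarrow> cis (phase p x \<xi>) * f \<xi>"
    proof (rule AE_I2)
      fix \<xi>
      have "continuous_on UNIV (\<lambda>p. cis (phase p x \<xi>) * f \<xi>)"
        by (intro continuous_intros)
      from continuous_on_tendsto_compose[OF this P]
      show "(\<lambda>n. cis (phase (P n) x \<xi>) * f \<xi>) \<longlonglongrightarrow> cis (phase p x \<xi>) * f \<xi>"
        by simp
    qed
    show "AE \<xi> in lborel. norm (cis (phase (P n) x \<xi>) * f \<xi>) \<le> norm (f \<xi>)" for n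
      by (simp add: norm_mult)
  qed measurable
  then show ?thesis
    by (auto simp: continuous_on_sequentially o_def)
qed

text \<open>
  The Bochner integral takes the value \<open>0\<close> on functions that are not integrable, and the unimodular
  factor does not affect integrability.
\<close>

lemma evolution_eq_0:
  assumes "\<not> integrable lborel f"
  shows "evolution f p x = 0"
proof -
  have "\<not> integrable lborel (\<lambda>\<xi>. cis (phase p x \<xi>) * f \<xi>)"
  proof
    assume "integrable lborel (\<lambda>\<xi>. cis (phase p x \<xi>) * f \<xi>)"
    then have "integrable lborel (\<lambda>\<xi>. cis (- phase p x \<xi>) * (cis (phase p x \<xi>) * f \<xi>))"
      by (rule integrable_cis_times) measurable
    moreover have "cis (- phase p x \<xi>) * (cis (phase p x \<xi>) * f \<xi>) = f \<xi>" for \<xi>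
      by (simp add: cis_mult flip: mult.assoc)
    ultimately show False using assms by simp
  qed
  then show ?thesis unfolding evolution_def by (rule not_integrable_integral_eq)
qed

section \<open>Mixed norms\<close>

lemma epowr_2: "epowr a 2 = a\<^sup>2"
  by (cases a) (auto simp: epowr_def ennreal_power)

lemma epowr_mono:
  assumes "a \<le> b" "r \<ge> 0"
  shows "epowr a r \<le> epowr b r"
proof (cases "b = \<infinity>")
  case False
  then have "a \<noteq> \<infinity>" using assms(1) by (auto simp: top_unique)
  then show ?thesis using False assms
    by (auto simp: epowr_def intro!: ennreal_leI powr_mono2 enn2real_mono simp: less_top)
qed (simp add: epowr_def)

lemma epowr_ennreal_mult:
  assumes "c > 0" "r > 0"
  shows "epowr (ennreal c * b) r = ennreal (c powr r) * epowr b r"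
proof (cases b)
  case (real b')
  then have "ennreal c * b = ennreal (c * b')" using assms by (simp add: ennreal_mult)
  moreover have "epowr (ennreal (c * b')) r = ennreal ((c * b') powr r)" "epowr b r = ennreal (b' powr r)"
    using real assms by (simp_all add: epowr_def)
  ultimately show ?thesis using real assms by (simp add: powr_mult ennreal_mult')
next
  case top
  then show ?thesis using assms by (simp add: epowr_def ennreal_mult_top)
qed

lemma sobolev_norm_eq:
  "sobolev_norm s \<phi> = epowr (\<integral>\<^sup>+\<xi>. (ennreal ((1 + (norm \<xi>)\<^sup>2) powr (s / 2) * norm (fourier \<phi> \<xi>)))\<^sup>2 \<partial>lborel) (1 / 2)"
  by (simp add: sobolev_norm_def Lp_norm_def epowr_2)

text \<open>
  For integrable \<open>fourier \<phi>\<close> the solution is continuous in \<open>(t, y, z)\<close>, so its supremum over a dense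
  sequence bounds it everywhere.
\<close>

lemma esssup_U_le:
  fixes q :: "nat \<Rightarrow> real \<times> real \<times> real"
  assumes f: "integrable lborel (fourier \<phi>)" and dense: "{0..T} \<times> UNIV \<subseteq> closure (range q)"
  shows "esssup (restrict_space lborel ({0..T} \<times> UNIV)) (\<lambda>(t, y, z). ennreal (norm (U t \<phi> (x, y, z))))
    \<le> ennreal ((2 * pi) powr (- 3 / 2)) * (SUP n. ennreal (norm (evolution (fourier \<phi>) (q n) x)))"
proof -
  define g where "g p = ennreal (norm (evolution (fourier \<phi>) p x))" for p
  have cont: "continuous_on UNIV g"
    unfolding g_def by (intro continuous_on_ennreal continuous_intros continuous_on_evolution[OF f])
  have eq: "(\<lambda>(t, y, z). ennreal (norm (U t \<phi> (x, y, z)))) = (\<lambda>p. ennreal ((2 * pi) powr (- 3 / 2)) * g p)"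
    by (auto simp: U_eq_evolution norm_mult ennreal_mult g_def)
  have "closed {p. g p \<le> (SUP n. g (q n))}"
    by (intro closed_Collect_le cont continuous_intros)
  moreover have "range q \<subseteq> {p. g p \<le> (SUP n. g (q n))}"
    by (rule image_subsetI, rule CollectI, rule SUP_upper) simp
  ultimately have "closure (range q) \<subseteq> {p. g p \<le> (SUP n. g (q n))}"
    by (intro closure_minimal)
  with dense have le: "g p \<le> (SUP n. g (q n))" if "p \<in> {0..T} \<times> UNIV" for p
    using that by auto
  have [measurable]: "g \<in> borel_measurable borel" by (rule borel_measurable_continuous_onI[OF cont])
  have "esssup (restrict_space lborel ({0..T} \<times> UNIV)) (\<lambda>p. ennreal ((2 * pi) powr (- 3 / 2)) * g p)
      \<le> ennreal ((2 * pi) powr (- 3 / 2)) * (SUP n. g (q n))"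
  proof (rule esssup_I)
    show "(\<lambda>p. ennreal ((2 * pi) powr (- 3 / 2)) * g p) \<in> borel_measurable (restrict_space lborel ({0..T} \<times> UNIV))"
      by (rule measurable_restrict_space1) measurable
    show "AE p in restrict_space lborel ({0..T} \<times> UNIV).
        ennreal ((2 * pi) powr (- 3 / 2)) * g p \<le> ennreal ((2 * pi) powr (- 3 / 2)) * (SUP n. g (q n))"
      by (rule AE_I2) (auto simp: space_restrict_space intro!: mult_left_mono le)
  qed
  then show ?thesis unfolding eq by (simp add: g_def)
qed

theorem proposition3p3:
  fixes s :: real
  assumes "s > 1"
  shows "\<exists>C::real. C > 0 \<and>
    (\<forall>T::real. \<forall>\<phi>::R3 \<Rightarrow> complex. 0 < T \<longrightarrow> T < 1 \<longrightarrow> schwartz \<phi> \<longrightarrow>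
       mixed_norm 2 \<infinity> T (\<lambda>t. U t \<phi>) \<le> ennreal C * sobolev_norm s \<phi>)"
proof -
  obtain C where C: "C > 0"
    and maximal: "\<And>(q :: nat \<Rightarrow> real \<times> real \<times> real) f. \<lbrakk>\<And>n. 0 \<le> fst (q n) \<and> fst (q n) \<le> 1; integrable lborel f\<rbrakk> \<Longrightarrow>
      (\<integral>\<^sup>+x. (SUP n. ennreal (norm (evolution f (q n) x)))\<^sup>2 \<partial>lborel)
        \<le> ennreal C * (\<integral>\<^sup>+\<xi>. (ennreal ((1 + (norm \<xi>)\<^sup>2) powr (s / 2) * norm (f \<xi>)))\<^sup>2 \<partial>lborel)"
    using maximal_bound[OF assms] by blast
  define c where "c = (2 * pi) powr (- 3 / 2)"
  have c: "c > 0" by (simp add: c_def)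
  have main: "mixed_norm 2 \<infinity> T (\<lambda>t. U t \<phi>) \<le> ennreal ((c\<^sup>2 * C) powr (1 / 2)) * sobolev_norm s \<phi>"
    if T: "0 < T" "T < 1" for T :: real and \<phi> :: "R3 \<Rightarrow> complex"
  proof -
    define u where "u x = esssup (restrict_space lborel ({0..T} \<times> UNIV)) (\<lambda>(t, y, z). ennreal (norm (U t \<phi> (x, y, z))))" for x
    define B where "B = (\<integral>\<^sup>+\<xi>. (ennreal ((1 + (norm \<xi>)\<^sup>2) powr (s / 2) * norm (fourier \<phi> \<xi>)))\<^sup>2 \<partial>lborel)"
    have "(\<integral>\<^sup>+x. (u x)\<^sup>2 \<partial>lborel) \<le> ennreal (c\<^sup>2 * C) * B"
    proof (cases "integrable lborel (fourier \<phi>)")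
      case True
      obtain D :: "(real \<times> real \<times> real) set" where D: "countable D" "D \<subseteq> {0..T} \<times> UNIV" "{0..T} \<times> UNIV \<subseteq> closure D"
        using separable by blast
      have "D \<noteq> {}" using D(3) T by auto
      define q where "q = from_nat_into D"
      have q: "range q = D" unfolding q_def using \<open>D \<noteq> {}\<close> D(1) by (rule range_from_nat_into)
      have q01: "0 \<le> fst (q n) \<and> fst (q n) \<le> 1" for n
      proof -
        have "q n \<in> {0..T} \<times> UNIV" using q D(2) by blast
        then show ?thesis using T by auto
      qed
      have u_le: "u x \<le> ennreal c * (SUP n. ennreal (norm (evolution (fourier \<phi>) (q n) x)))" for x
        unfolding u_def c_def by (rule esssup_U_le[OF True]) (use D q in auto)
      have "(\<integral>\<^sup>+x. (u x)\<^sup>2 \<partial>lborel) \<le> (\<integral>\<^sup>+x. ennreal (c\<^sup>2) * (SUP n. ennreal (norm (evolution (fourier \<phi>) (q n) x)))\<^sup>2 \<partial>lborel)"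
      proof (rule nn_integral_mono)
        fix x
        show "(u x)\<^sup>2 \<le> ennreal (c\<^sup>2) * (SUP n. ennreal (norm (evolution (fourier \<phi>) (q n) x)))\<^sup>2"
          using power_mono[OF u_le[of x], of 2] c by (simp add: power_mult_distrib ennreal_power)
      qed
      also have "\<dots> = ennreal (c\<^sup>2) * (\<integral>\<^sup>+x. (SUP n. ennreal (norm (evolution (fourier \<phi>) (q n) x)))\<^sup>2 \<partial>lborel)"
      proof (rule nn_integral_cmult)
        have [measurable]: "fourier \<phi> \<in> borel_measurable borel" using True by auto
        show "(\<lambda>x. (SUP n. ennreal (norm (evolution (fourier \<phi>) (q n) x)))\<^sup>2) \<in> borel_measurable lborel"
          by measurable
      qed
      also have "\<dots> \<le> ennreal (c\<^sup>2) * (ennreal C * B)"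
        unfolding B_def by (intro mult_left_mono maximal q01 True) simp
      also have "\<dots> = ennreal (c\<^sup>2 * C) * B"
        using C by (simp add: ennreal_mult mult.assoc)
      finally show ?thesis .
    next
      case False
      \<comment> \<open>Here every integral that defines the solution takes its default value \<open>0\<close>.\<close>
      then have "(\<lambda>(t, y, z). ennreal (norm (U t \<phi> (x, y, z)))) = (\<lambda>_. 0)" for x
        by (auto simp: U_eq_evolution evolution_eq_0)
      then have "u x \<le> 0" for x
        unfolding u_def by (simp only:) (rule esssup_I, auto)
      then show ?thesis by simp
    qed
    then have "epowr (\<integral>\<^sup>+x. (u x)\<^sup>2 \<partial>lborel) (1 / 2) \<le> epowr (ennreal (c\<^sup>2 * C) * B) (1 / 2)"
      by (rule epowr_mono) simp
    also have "\<dots> = ennreal ((c\<^sup>2 * C) powr (1 / 2)) * sobolev_norm s \<phi>"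
      unfolding sobolev_norm_eq B_def using c C by (intro epowr_ennreal_mult) auto
    also have "epowr (\<integral>\<^sup>+x. (u x)\<^sup>2 \<partial>lborel) (1 / 2) = mixed_norm 2 \<infinity> T (\<lambda>t. U t \<phi>)"
      by (simp add: mixed_norm_def Lp_norm_def epowr_2 u_def)
    finally show ?thesis .
  qed
  show ?thesis
    by (rule exI[of _ "(c\<^sup>2 * C) powr (1 / 2)"]) (use main c C in auto)
qed

end
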